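(* Let $\mathscr{G}_{jk,p}^{st}$ be the two-dimensional Yetter-Drinfeld module over $A_{N\,2n}^{\mu\lambda}$ defined in the context, with $1\le s\le N$, $0\le t\le n-1$, $0\le k\le N-1$, $p\in\{0,1\}$, and $\frac j2\in\{1,\dots,n-1\}$ if $\lambda=1$, $\frac{j+1}{2}\in\{1,\dots,n\}$ if $\lambda=-1$. Then $\mathfrak{B}(\mathscr{G}_{jk,p}^{st})$ is of type $V_{abe}$, where $$ae=\bar\mu^{2s+2t+1}\omega^{4kn(4s+4t+2)+jN(-2-4t)},\qquad b=(-1)^p\bar\mu^{s+t+\frac12}\omega^{4nk(2s+2t+1)+jN(2t+1)}.$$
   Context: $\Bbbk$ is an algebraically closed field of characteristic $0$; $N,n\ge1$ are integers and $\mu,\lambda\in\{1,-1\}$. The Suzuki algebra $A=A_{N\,2n}^{\mu\lambda}$ is the Hopf algebra over $\Bbbk$ generated by $x_{11},x_{12},x_{21},x_{22}$ with relations $x_{11}^2=x_{22}^2$, $x_{12}^2=x_{21}^2$, $\chi_{21}^{2n}=\lambda\chi_{12}^{2n}$, $\chi_{11}^{2n}=\chi_{22}^{2n}$, $x_{11}^{2N}+\mu x_{12}^{2N}=1$, and $x_{ij}x_{kl}=0$ whenever $i+j+k+l$ is odd. Here $\chi_{11}^m=x_{11}x_{22}x_{11}\cdots$, $\chi_{22}^m=x_{22}x_{11}x_{22}\cdots$, $\chi_{12}^m=x_{12}x_{21}x_{12}\cdots$, $\chi_{21}^m=x_{21}x_{12}x_{21}\cdots$ are alternating products with $m$ factors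 ($\chi^0=1$). $\Delta(x_{ij})=x_{i1}\otimes x_{1j}+x_{i2}\otimes x_{2j}$, $\varepsilon(x_{ij})=\delta_{ij}$, $S(x_{ij})=x_{ji}^{4N-1}$. Fix a primitive $8nN$-th root of unity $\omega$. Put $\bar\mu=1$ if $\mu=1$ and $\bar\mu=\omega^{4n}$ if $\mu=-1$; fix a square root $\sqrt{\bar\mu}$ and read $\bar\mu^{m+\frac12}$ as $\bar\mu^m\sqrt{\bar\mu}$. $V_{jk}'=\Bbbk v_1'\oplus\Bbbk v_2'$ is the left $A$-module with $x_{11},x_{22}$ acting by $0$, $x_{21}v_1'=\omega^{2jN}v_2'$, $x_{21}v_2'=\bar\mu\omega^{2(4kn-jN)}v_1'$, $x_{12}v_1'=v_2'$, $x_{12}v_2'=\bar\mu\omega^{8kn}v_1'$. For a left $A$-module $V$, $V\boxtimes A$ is the vector space $V\otimes A$ (elements $\ell\boxtimes g$) with the left-left Yetter-Drinfeld structure $h\cdot(\ell\boxtimes g)=(h_{(2)}\cdot\ell)\boxtimes h_{(1)}gS(h_{(3)})$, $\rho(\ell\boxtimes g)=g_{(1)}\otimes(\ell\boxtimes g_{(2)})$. $\mathscr{G}_{jk,p}^{st}=\Bbbk w_1\oplus\Bbbk w_2\subset V_{jk}'\boxtimes A$ is the Yetter-Drinfeld submodule with $w_1=v_1'\boxtimes x_{11}^{2s+1}\chi_{22}^{2t}+\frac{(-1)^p\omega^{jN-4kn}}{\sqrt{\bar\mu}}v_2'\boxtimes x_{12}^{2s+1}\chi_{21}^{2t}$, $w_2=v_2'\boxtimes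 x_{11}^{2s}\chi_{22}^{2t+1}+(-1)^p\sqrt{\bar\mu}\,\omega^{4kn-jN}v_1'\boxtimes x_{12}^{2s}\chi_{21}^{2t+1}$. The braiding of a Yetter-Drinfeld module $M$ is $c(x\otimes y)=x_{(-1)}\cdot y\otimes x_{(0)}$; $\mathfrak{B}(M)$ is its Nichols algebra. $\mathfrak{B}(M)$ is of type $V_{abe}$ if $(M,c)$ is isomorphic, as braided vector space, to $V_{abe}=\Bbbk v_1\oplus\Bbbk v_2$ with $c(v_1\otimes v_1)=a\,v_2\otimes v_2$, $c(v_1\otimes v_2)=b\,v_1\otimes v_2$, $c(v_2\otimes v_1)=b\,v_2\otimes v_1$, $c(v_2\otimes v_2)=e\,v_1\otimes v_1$, for some $a,b,e\in\Bbbk^\times$. (Since $V_{abe}\cong V_{ae\,b\,1}$, only $ae$ and $b$ matter up to isomorphism.) *)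

theory Defs
  imports
    "HOL-Library.Poly_Mapping"
    "HOL-Library.Product_Plus"
    "HOL-Computational_Algebra.Polynomial"
begin

section \<open>Free vector spaces and tensor products\<close>

text \<open>
  The type \<open>'b \<Rightarrow>\<^sub>0 'k\<close> is the vector space over \<open>'k\<close> with basis \<open>'b\<close>; the tensor product of
  the spaces with bases \<open>'b\<close> and \<open>'c\<close> is the space with basis \<open>'b \<times> 'c\<close>.  A quotient
  \<open>X / R\<close> of a free space \<open>X\<close> by a subspace \<open>R\<close> is handled by computing in \<open>X\<close> modulo \<open>R\<close>, and
  \<open>X/R \<otimes> Y/S\<close> is the quotient of \<open>X \<otimes> Y\<close> by \<open>R \<otimes> Y + X \<otimes> S\<close>.
\<close>

definition smul :: "'k::field \<Rightarrow> ('b \<Rightarrow>\<^sub>0 'k) \<Rightarrow> ('b \<Rightarrow>\<^sub>0 'k)" where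
  "smul c p = Poly_Mapping.map ((*) c) p"

lemma lookup_smul: "Poly_Mapping.lookup (smul c p) b = c * Poly_Mapping.lookup p b"
  by (simp add: smul_def Poly_Mapping.map.rep_eq when_def)

global_interpretation fs: vector_space "smul :: 'k::field \<Rightarrow> ('b \<Rightarrow>\<^sub>0 'k) \<Rightarrow> ('b \<Rightarrow>\<^sub>0 'k)"
  by standard
    (auto intro!: poly_mapping_eqI simp: lookup_smul lookup_add algebra_simps)

abbreviation bas :: "'b \<Rightarrow> ('b \<Rightarrow>\<^sub>0 'k::field)" where
  "bas b \<equiv> Poly_Mapping.single b 1"

text \<open>The linear map with prescribed values on the basis.\<close>
definition lin_ext :: "('b \<Rightarrow> ('c \<Rightarrow>\<^sub>0 'k)) \<Rightarrow> ('b \<Rightarrow>\<^sub>0 'k::field) \<Rightarrow> ('c \<Rightarrow>\<^sub>0 'k)" where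
  "lin_ext f p = (\<Sum>b\<in>Poly_Mapping.keys p. smul (Poly_Mapping.lookup p b) (f b))"

definition tens :: "('b \<Rightarrow>\<^sub>0 'k::field) \<Rightarrow> ('c \<Rightarrow>\<^sub>0 'k) \<Rightarrow> ('b \<times> 'c \<Rightarrow>\<^sub>0 'k)" where
  "tens p q = lin_ext (\<lambda>b. lin_ext (\<lambda>c. bas (b, c)) q) p"

text \<open>The tensor product of two linear maps.\<close>
definition map_tens ::
  "(('b \<Rightarrow>\<^sub>0 'k::field) \<Rightarrow> ('d \<Rightarrow>\<^sub>0 'k)) \<Rightarrow> (('c \<Rightarrow>\<^sub>0 'k) \<Rightarrow> ('e \<Rightarrow>\<^sub>0 'k))
    \<Rightarrow> ('b \<times> 'c \<Rightarrow>\<^sub>0 'k) \<Rightarrow> ('d \<times> 'e \<Rightarrow>\<^sub>0 'k)" where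
  "map_tens f g = lin_ext (\<lambda>(b, c). tens (f (bas b)) (g (bas c)))"

text \<open>The subspace \<open>R \<otimes> Y + X \<otimes> S\<close> of \<open>X \<otimes> Y\<close>.\<close>
definition rel_tens ::
  "('b \<Rightarrow>\<^sub>0 'k::field) set \<Rightarrow> ('c \<Rightarrow>\<^sub>0 'k) set \<Rightarrow> ('b \<times> 'c \<Rightarrow>\<^sub>0 'k) set" where
  "rel_tens R S = fs.span ({tens r q |r q. r \<in> R} \<union> {tens p s |p s. s \<in> S})"


section \<open>The Suzuki algebra\<close>

datatype idx = I1 | I2

fun ix :: "idx \<Rightarrow> nat" where
  "ix I1 = 1"
| "ix I2 = 2"

text \<open>
  Words form a monoid under concatenation.  The product of \<open>'b \<Rightarrow>\<^sub>0 'k\<close> is then that of the monoid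
  algebra, so that \<open>word \<Rightarrow>\<^sub>0 'k\<close> is the free algebra on the four letters \<open>(i, j)\<close> and
  \<open>word \<times> word \<Rightarrow>\<^sub>0 'k\<close> is its tensor square as an algebra.
\<close>
instantiation list :: (type) monoid_add
begin
definition zero_list :: "'a list" where "zero_list = []"
definition plus_list :: "'a list \<Rightarrow> 'a list \<Rightarrow> 'a list" where "plus_list = (@)"
instance by standard (simp_all add: zero_list_def plus_list_def)
end

type_synonym word = "(idx \<times> idx) list"
type_synonym 'k free_alg = "word \<Rightarrow>\<^sub>0 'k"

definition X :: "idx \<Rightarrow> idx \<Rightarrow> 'k::field free_alg" where
  "X i j = bas [(i, j)]"

fun alt_prod :: "'a::monoid_mult \<Rightarrow> 'a \<Rightarrow> nat \<Rightarrow> 'a" where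
  "alt_prod a b 0 = 1"
| "alt_prod a b (Suc m) = a * alt_prod b a m"

fun other :: "idx \<Rightarrow> idx" where
  "other I1 = I2"
| "other I2 = I1"

definition chi :: "idx \<Rightarrow> idx \<Rightarrow> nat \<Rightarrow> 'k::field free_alg" where
  "chi i j m = alt_prod (X i j) (X (other i) (other j)) m"

definition suzuki_relators :: "nat \<Rightarrow> nat \<Rightarrow> 'k::field \<Rightarrow> 'k \<Rightarrow> 'k free_alg set" where
  "suzuki_relators N n \<mu> lam =
     {X I1 I1 ^ 2 - X I2 I2 ^ 2,
      X I1 I2 ^ 2 - X I2 I1 ^ 2,
      chi I2 I1 (2 * n) - smul lam (chi I1 I2 (2 * n)),
      chi I1 I1 (2 * n) - chi I2 I2 (2 * n),
      X I1 I1 ^ (2 * N) + smul \<mu> (X I1 I2 ^ (2 * N)) - 1}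
     \<union> {X i j * X k l |i j k l. odd (ix i + ix j + ix k + ix l)}"

text \<open>The two-sided ideal of the free algebra whose quotient is the Suzuki algebra.\<close>
definition suzuki_ideal :: "nat \<Rightarrow> nat \<Rightarrow> 'k::field \<Rightarrow> 'k \<Rightarrow> 'k free_alg set" where
  "suzuki_ideal N n \<mu> lam = fs.span {u * r * v |u r v. r \<in> suzuki_relators N n \<mu> lam}"

text \<open>
  The comultiplication (an algebra homomorphism) and the antipode (an algebra antihomomorphism),
  both given by their values on the letters and lifted to the free algebra.
\<close>
definition \<Delta> :: "'k::field free_alg \<Rightarrow> (word \<times> word \<Rightarrow>\<^sub>0 'k)" where
  "\<Delta> = lin_ext (\<lambda>w. prod_list (map (\<lambda>(i, j).
          tens (X i I1) (X I1 j) + tens (X i I2) (X I2 j)) w))"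

definition antipode :: "nat \<Rightarrow> 'k::field free_alg \<Rightarrow> 'k free_alg" where
  "antipode N = lin_ext (\<lambda>w. prod_list (map (\<lambda>(i, j). X j i ^ (4 * N - 1)) (rev w)))"

text \<open>\<open>h\<^sub>(\<^sub>1\<^sub>) \<otimes> h\<^sub>(\<^sub>2\<^sub>) \<otimes> h\<^sub>(\<^sub>3\<^sub>)\<close>, bracketed to the left.\<close>
definition \<Delta>2 :: "'k::field free_alg \<Rightarrow> ((word \<times> word) \<times> word \<Rightarrow>\<^sub>0 'k)" where
  "\<Delta>2 h = map_tens \<Delta> (\<lambda>g. g) (\<Delta> h)"


section \<open>The Yetter-Drinfeld module \<open>V \<boxtimes> A\<close>\<close>

text \<open>
  A left module \<open>V\<close> with basis \<open>'v\<close> is given by the action \<open>act\<close> of the letters on the basis;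
  \<open>word_act\<close> is the resulting action of a word.
\<close>
type_synonym ('v, 'k) gen_act = "idx \<times> idx \<Rightarrow> 'v \<Rightarrow> ('v \<Rightarrow>\<^sub>0 'k)"

fun word_act :: "('v, 'k::field) gen_act \<Rightarrow> word \<Rightarrow> ('v \<Rightarrow>\<^sub>0 'k) \<Rightarrow> ('v \<Rightarrow>\<^sub>0 'k)" where
  "word_act act [] m = m"
| "word_act act (g # w) m = lin_ext (act g) (word_act act w m)"

text \<open>\<open>h \<cdot> (\<ell> \<boxtimes> g) = (h\<^sub>(\<^sub>2\<^sub>) \<cdot> \<ell>) \<boxtimes> h\<^sub>(\<^sub>1\<^sub>) g S(h\<^sub>(\<^sub>3\<^sub>))\<close>\<close>
definition yd_act :: "('v, 'k::field) gen_act \<Rightarrow> nat \<Rightarrow> 'k free_alg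
    \<Rightarrow> ('v \<times> word \<Rightarrow>\<^sub>0 'k) \<Rightarrow> ('v \<times> word \<Rightarrow>\<^sub>0 'k)" where
  "yd_act act N h = lin_ext (\<lambda>(l, g).
     lin_ext (\<lambda>((h1, h2), h3).
        tens (word_act act h2 (bas l)) (bas h1 * bas g * antipode N (bas h3))) (\<Delta>2 h))"

text \<open>\<open>\<rho>(\<ell> \<boxtimes> g) = g\<^sub>(\<^sub>1\<^sub>) \<otimes> (\<ell> \<boxtimes> g\<^sub>(\<^sub>2\<^sub>))\<close>\<close>
definition yd_coact :: "('v \<times> word \<Rightarrow>\<^sub>0 'k::field) \<Rightarrow> (word \<times> ('v \<times> word) \<Rightarrow>\<^sub>0 'k)" where
  "yd_coact = lin_ext (\<lambda>(l, g). lin_ext (\<lambda>(g1, g2). bas (g1, (l, g2))) (\<Delta> (bas g)))"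

text \<open>\<open>c(x \<otimes> y) = x\<^sub>(\<^sub>-\<^sub>1\<^sub>) \<cdot> y \<otimes> x\<^sub>(\<^sub>0\<^sub>)\<close>\<close>
definition yd_braid :: "('v, 'k::field) gen_act \<Rightarrow> nat
    \<Rightarrow> (('v \<times> word) \<times> ('v \<times> word) \<Rightarrow>\<^sub>0 'k) \<Rightarrow> (('v \<times> word) \<times> ('v \<times> word) \<Rightarrow>\<^sub>0 'k)" where
  "yd_braid act N = lin_ext (\<lambda>(x, y).
     lin_ext (\<lambda>(h, x0). tens (yd_act act N (bas h) (bas y)) (bas x0)) (yd_coact (bas x)))"

text \<open>The kernel \<open>V \<otimes> I\<close> of \<open>V \<otimes> F \<rightarrow> V \<boxtimes> A\<close>, where \<open>F\<close> is the free algebra and \<open>A = F / I\<close>.\<close>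
definition yd_rel :: "nat \<Rightarrow> nat \<Rightarrow> 'k::field \<Rightarrow> 'k \<Rightarrow> ('v \<times> word \<Rightarrow>\<^sub>0 'k) set" where
  "yd_rel N n \<mu> lam = rel_tens {0} (suzuki_ideal N n \<mu> lam)"


section \<open>The braided vector spaces \<open>V\<^sub>a\<^sub>b\<^sub>e\<close>\<close>

fun V_abe_basis :: "'k::field \<Rightarrow> 'k \<Rightarrow> 'k \<Rightarrow> idx \<times> idx \<Rightarrow> (idx \<times> idx \<Rightarrow>\<^sub>0 'k)" where
  "V_abe_basis a b e (I1, I1) = smul a (bas (I2, I2))"
| "V_abe_basis a b e (I1, I2) = smul b (bas (I1, I2))"
| "V_abe_basis a b e (I2, I1) = smul b (bas (I2, I1))"
| "V_abe_basis a b e (I2, I2) = smul e (bas (I1, I1))"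

definition V_abe_braid :: "'k::field \<Rightarrow> 'k \<Rightarrow> 'k \<Rightarrow> (idx \<times> idx \<Rightarrow>\<^sub>0 'k) \<Rightarrow> (idx \<times> idx \<Rightarrow>\<^sub>0 'k)" where
  "V_abe_braid a b e = lin_ext (V_abe_basis a b e)"

text \<open>
  Let \<open>R \<subseteq> W\<close> be subspaces of a free space \<open>Y\<close> and \<open>c\<close> a linear endomorphism of \<open>Y \<otimes> Y\<close>.
  The first conjunct says that \<open>c\<close> induces a map on \<open>Y/R \<otimes> Y/R\<close>; the rest says that there is a
  linear isomorphism from \<open>V\<^sub>a\<^sub>b\<^sub>e\<close> onto the subspace \<open>W/R\<close> of \<open>Y/R\<close> that intertwines the
  braidings.  In particular the induced map restricts to \<open>W/R \<otimes> W/R\<close>.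
\<close>
definition is_type_V_abe :: "'k::field \<Rightarrow> 'k \<Rightarrow> 'k \<Rightarrow> ('y \<Rightarrow>\<^sub>0 'k) set \<Rightarrow> ('y \<Rightarrow>\<^sub>0 'k) set
    \<Rightarrow> (('y \<times> 'y \<Rightarrow>\<^sub>0 'k) \<Rightarrow> ('y \<times> 'y \<Rightarrow>\<^sub>0 'k)) \<Rightarrow> bool" where
  "is_type_V_abe a b e W R c \<longleftrightarrow>
     a \<noteq> 0 \<and> b \<noteq> 0 \<and> e \<noteq> 0 \<and>
     c ` rel_tens R R \<subseteq> rel_tens R R \<and>
     (\<exists>\<phi> :: (idx \<Rightarrow>\<^sub>0 'k) \<Rightarrow> ('y \<Rightarrow>\<^sub>0 'k).
        Vector_Spaces.linear smul smul \<phi> \<and>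
        (\<forall>u. \<phi> u \<in> R \<longrightarrow> u = 0) \<and>
        W = {\<phi> u + r |u r. r \<in> R} \<and>
        (\<forall>z. c (map_tens \<phi> \<phi> z) - map_tens \<phi> \<phi> (V_abe_braid a b e z) \<in> rel_tens R R))"


section \<open>The module \<open>V'\<^sub>j\<^sub>k\<close> and the Yetter-Drinfeld module \<open>G\<close>\<close>

definition primitive_root_of_one :: "nat \<Rightarrow> 'k::field \<Rightarrow> bool" where
  "primitive_root_of_one m \<omega> \<longleftrightarrow> \<omega> ^ m = 1 \<and> (\<forall>i. 0 < i \<and> i < m \<longrightarrow> \<omega> ^ i \<noteq> 1)"

definition mu_bar :: "nat \<Rightarrow> 'k::field \<Rightarrow> 'k \<Rightarrow> 'k" where
  "mu_bar n \<mu> \<omega> = (if \<mu> = 1 then 1 else \<omega> ^ (4 * n))"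

fun V'_act :: "nat \<Rightarrow> nat \<Rightarrow> 'k::field \<Rightarrow> 'k \<Rightarrow> nat \<Rightarrow> nat \<Rightarrow> (idx, 'k) gen_act" where
  "V'_act N n \<mu> \<omega> j k (I2, I1) I1 = smul (\<omega> ^ (2 * j * N)) (bas I2)"
| "V'_act N n \<mu> \<omega> j k (I2, I1) I2 =
     smul (mu_bar n \<mu> \<omega> * \<omega> powi (2 * (4 * int k * int n - int j * int N))) (bas I1)"
| "V'_act N n \<mu> \<omega> j k (I1, I2) I1 = bas I2"
| "V'_act N n \<mu> \<omega> j k (I1, I2) I2 = smul (mu_bar n \<mu> \<omega> * \<omega> ^ (8 * k * n)) (bas I1)"
| "V'_act N n \<mu> \<omega> j k (I1, I1) l = 0"
| "V'_act N n \<mu> \<omega> j k (I2, I2) l = 0"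

text \<open>Here \<open>q\<close> is the chosen square root of \<open>mu_bar n \<mu> \<omega>\<close>.\<close>
definition G_w1 :: "nat \<Rightarrow> nat \<Rightarrow> 'k::field \<Rightarrow> 'k \<Rightarrow> nat \<Rightarrow> nat \<Rightarrow> nat \<Rightarrow> nat \<Rightarrow> nat
    \<Rightarrow> (idx \<times> word \<Rightarrow>\<^sub>0 'k)" where
  "G_w1 N n \<omega> q j k p s t =
     tens (bas I1) (X I1 I1 ^ (2 * s + 1) * chi I2 I2 (2 * t))
     + smul ((- 1) ^ p * \<omega> powi (int j * int N - 4 * int k * int n) / q)
         (tens (bas I2) (X I1 I2 ^ (2 * s + 1) * chi I2 I1 (2 * t)))"

definition G_w2 :: "nat \<Rightarrow> nat \<Rightarrow> 'k::field \<Rightarrow> 'k \<Rightarrow> nat \<Rightarrow> nat \<Rightarrow> nat \<Rightarrow> nat \<Rightarrow> nat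
    \<Rightarrow> (idx \<times> word \<Rightarrow>\<^sub>0 'k)" where
  "G_w2 N n \<omega> q j k p s t =
     tens (bas I2) (X I1 I1 ^ (2 * s) * chi I2 I2 (2 * t + 1))
     + smul ((- 1) ^ p * q * \<omega> powi (4 * int k * int n - int j * int N))
         (tens (bas I1) (X I1 I2 ^ (2 * s) * chi I2 I1 (2 * t + 1)))"

text \<open>The preimage in \<open>V'\<^sub>j\<^sub>k \<otimes> F\<close> of the span of \<open>w\<^sub>1\<close> and \<open>w\<^sub>2\<close> in \<open>V'\<^sub>j\<^sub>k \<boxtimes> A\<close>.\<close>
definition G_space :: "nat \<Rightarrow> nat \<Rightarrow> 'k::field \<Rightarrow> 'k \<Rightarrow> 'k \<Rightarrow> 'k \<Rightarrow> nat \<Rightarrow> nat \<Rightarrow> nat \<Rightarrow> nat \<Rightarrow> nat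
    \<Rightarrow> (idx \<times> word \<Rightarrow>\<^sub>0 'k) set" where
  "G_space N n \<mu> lam \<omega> q j k p s t =
     fs.span ({G_w1 N n \<omega> q j k p s t, G_w2 N n \<omega> q j k p s t} \<union> yd_rel N n \<mu> lam)"

text \<open>
  The Nichols algebra of \<open>G\<close> is of type \<open>V\<^sub>a\<^sub>b\<^sub>e\<close>: by definition this is a property of the
  braided vector space \<open>G\<close> alone.
\<close>
definition nichols_G_of_type_V_abe :: "'k::field \<Rightarrow> 'k \<Rightarrow> 'k \<Rightarrow> nat \<Rightarrow> nat \<Rightarrow> 'k \<Rightarrow> 'k \<Rightarrow> 'k \<Rightarrow> 'k
    \<Rightarrow> nat \<Rightarrow> nat \<Rightarrow> nat \<Rightarrow> nat \<Rightarrow> nat \<Rightarrow> bool" where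
  "nichols_G_of_type_V_abe a b e N n \<mu> lam \<omega> q j k p s t \<longleftrightarrow>
     is_type_V_abe a b e (G_space N n \<mu> lam \<omega> q j k p s t) (yd_rel N n \<mu> lam)
       (yd_braid (V'_act N n \<mu> \<omega> j k) N)"

end

theory Submission
  imports Defs
begin

text \<open>
  For a sign \<open>s\<close> let \<open>wd s ws\<close> be the word in \<open>x\<^sub>1\<^sub>1, x\<^sub>2\<^sub>2\<close> (\<open>s\<close> false) or in \<open>x\<^sub>1\<^sub>2, x\<^sub>2\<^sub>1\<close> (\<open>s\<close> true)
  with first indices \<open>ws\<close>.  Products of words of different signs vanish in \<open>A\<close>, so that
  \<open>\<Delta> (wd s ws) = wd False ws \<otimes> wd s ws + wd True ws \<otimes> wd (\<not> s) ws'\<close>, where \<open>ws'\<close> has the indices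
  \<open>1\<close> and \<open>2\<close> exchanged.  Within one sign, \<open>x\<^sub>1\<^sub>1\<^sup>2 = x\<^sub>2\<^sub>2\<^sup>2\<close> and \<open>x\<^sub>1\<^sub>2\<^sup>2 = x\<^sub>2\<^sub>1\<^sup>2\<close> are central and their
  \<open>2N\<close>-th powers act as the identity.  Hence \<open>x\<^sub>1\<^sub>1\<close> and \<open>x\<^sub>2\<^sub>2\<close> annihilate \<open>w\<^sub>1\<close> and \<open>w\<^sub>2\<close>, while \<open>x\<^sub>1\<^sub>2\<close> and
  \<open>x\<^sub>2\<^sub>1\<close> exchange the lines through \<open>w\<^sub>1\<close> and \<open>w\<^sub>2\<close> by the same scalars as for \<open>v'\<^sub>1\<close> and \<open>v'\<^sub>2\<close>.  With
  \<open>\<rho> w\<^sub>l = wd False g\<^sub>l \<otimes> w\<^sub>l + c\<^sub>l (wd True g\<^sub>l \<otimes> w\<^sub>m)\<close>, \<open>m \<noteq> l\<close>, only the second summand contributes to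
  the braiding, which therefore has the form \<open>V\<^sub>a\<^sub>b\<^sub>e\<close>.
\<close>

section \<open>Linear maps on free spaces\<close>

abbreviation lin :: "(('b \<Rightarrow>\<^sub>0 'k::field) \<Rightarrow> ('c \<Rightarrow>\<^sub>0 'k)) \<Rightarrow> bool" where
  "lin \<equiv> Vector_Spaces.linear smul smul"

lemma linI:
  assumes "\<And>x y. f (x + y) = f x + f y" "\<And>c x. f (smul c x) = smul c (f x)"
  shows "lin f"
  using assms by unfold_locales auto

lemma lin_add: "lin f \<Longrightarrow> f (x + y) = f x + f y"
  by (rule module_hom.add) (simp add: Vector_Spaces.linear_iff_module_hom)

lemma lin_smul: "lin f \<Longrightarrow> f (smul c x) = smul c (f x)"
  by (rule module_hom.scale) (simp add: Vector_Spaces.linear_iff_module_hom)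

lemma lin_0: "lin f \<Longrightarrow> f 0 = 0"
  by (rule module_hom.zero) (simp add: Vector_Spaces.linear_iff_module_hom)

lemma lin_diff: "lin f \<Longrightarrow> f (x - y) = f x - f y"
  by (rule module_hom.diff) (simp add: Vector_Spaces.linear_iff_module_hom)

lemma lin_sum: "lin f \<Longrightarrow> f (sum g A) = (\<Sum>a\<in>A. f (g a))"
  by (rule module_hom.sum) (simp add: Vector_Spaces.linear_iff_module_hom)

lemmas lin_simps = lin_add lin_smul lin_0 lin_diff

lemma poly_mapping_sum_bas: "p = (\<Sum>b\<in>Poly_Mapping.keys p. smul (Poly_Mapping.lookup p b) (bas b))"
proof (rule poly_mapping_eqI)
  fix k
  have "Poly_Mapping.lookup (\<Sum>b\<in>Poly_Mapping.keys p. smul (Poly_Mapping.lookup p b) (bas b)) k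
     = (\<Sum>b\<in>Poly_Mapping.keys p. Poly_Mapping.lookup p b * (if b = k then 1 else 0))"
    by (simp add: lookup_sum lookup_smul lookup_single when_def)
  also have "\<dots> = Poly_Mapping.lookup p k"
    by (simp add: sum.delta in_keys_iff if_distrib cong: if_cong)
  finally show "Poly_Mapping.lookup p k = Poly_Mapping.lookup (\<Sum>b\<in>Poly_Mapping.keys p. smul (Poly_Mapping.lookup p b) (bas b)) k" ..
qed

text \<open>Keys outside the support carry coefficient 0. A common finite index set is what
  additivity of \<open>lin_ext\<close> needs, since cancellation can make the support of a sum
  smaller than the union of the supports.\<close>

lemma lin_ext_superset:
  assumes "finite B" "Poly_Mapping.keys p \<subseteq> B"
  shows "lin_ext f p = (\<Sum>b\<in>B. smul (Poly_Mapping.lookup p b) (f b))"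
  unfolding lin_ext_def
  by (rule sum.mono_neutral_left) (use assms in \<open>auto simp: in_keys_iff\<close>)

lemma lin_lin_ext:
  fixes f :: "'a \<Rightarrow> ('c \<Rightarrow>\<^sub>0 'b::field)"
  shows "lin (lin_ext f)"
proof (rule linI)
  fix x y :: "'a \<Rightarrow>\<^sub>0 'b"
  let ?B = "Poly_Mapping.keys x \<union> Poly_Mapping.keys y"
  have "lin_ext f (x + y) = (\<Sum>b\<in>?B. smul (Poly_Mapping.lookup (x+y) b) (f b))"
    by (rule lin_ext_superset) (simp_all add: Poly_Mapping.keys_add)
  also have "\<dots> = lin_ext f x + lin_ext f y"
    by (simp add: lin_ext_superset[of ?B] lookup_add fs.scale_left_distrib sum.distrib)
  finally show "lin_ext f (x + y) = lin_ext f x + lin_ext f y" .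
next
  fix c :: 'b and x :: "'a \<Rightarrow>\<^sub>0 'b"
  have "lin_ext f (smul c x) = (\<Sum>b\<in>Poly_Mapping.keys x. smul (Poly_Mapping.lookup (smul c x) b) (f b))"
    by (rule lin_ext_superset) (auto simp: in_keys_iff lookup_smul)
  then show "lin_ext f (smul c x) = smul c (lin_ext f x)"
    by (simp add: lin_ext_def lookup_smul fs.scale_sum_right)
qed

lemma lin_ext_bas [simp]: "lin_ext f (bas b) = f b"
  by (simp add: lin_ext_def)

text \<open>Applied once per argument, this reduces a multilinear identity to basis elements; the
  rules collected in \<open>lin_intros\<close> supply the linearity premises.\<close>

lemma lin_eqI:
  assumes "lin f" "lin g" "\<And>b. f (bas b) = g (bas b)"
  shows "f p = g p"
proof -
  have "f p = (\<Sum>b\<in>Poly_Mapping.keys p. smul (Poly_Mapping.lookup p b) (f (bas b)))"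
    by (subst poly_mapping_sum_bas[of p]) (simp only: lin_sum[OF assms(1)] lin_smul[OF assms(1)])
  also have "\<dots> = g p"
    by (subst (3) poly_mapping_sum_bas[of p])
      (simp only: lin_sum[OF assms(2)] lin_smul[OF assms(2)] assms(3))
  finally show ?thesis .
qed

named_theorems lin_intros

lemma lin_id [lin_intros]: "lin (\<lambda>x. x)"
  by (rule linI) auto

lemma lin_zero_map [lin_intros]: "lin (\<lambda>x. 0)"
  by (rule linI) auto

lemma lin_plus [lin_intros]: "lin f \<Longrightarrow> lin g \<Longrightarrow> lin (\<lambda>x. f x + g x)"
  by (rule linI) (auto simp: lin_add lin_smul fs.scale_right_distrib)

lemma lin_minus [lin_intros]: "lin f \<Longrightarrow> lin g \<Longrightarrow> lin (\<lambda>x. f x - g x)"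
  by (rule linI) (auto simp: lin_add lin_smul fs.scale_right_diff_distrib)

lemma lin_scale [lin_intros]: "lin f \<Longrightarrow> lin (\<lambda>x. smul c (f x))"
  by (rule linI) (auto simp: lin_add lin_smul fs.scale_right_distrib mult.commute)

lemma lin_lin_ext' [lin_intros]: "lin f \<Longrightarrow> lin (\<lambda>x. lin_ext g (f x))"
  by (rule linI) (auto simp: lin_simps lin_simps[OF lin_lin_ext])

lemma lin_lin_ext_param [lin_intros]:
  assumes "\<And>b. lin (\<lambda>x. h b x)"
  shows "lin (\<lambda>x. lin_ext (\<lambda>b. h b x) p)"
  by (rule linI) (simp_all add: lin_ext_def lin_add[OF assms] lin_smul[OF assms]
      fs.scale_right_distrib sum.distrib fs.scale_sum_right mult.commute)

lemma lin_lin_ext_case_param [lin_intros]: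
  assumes "\<And>a b. lin (\<lambda>x. h a b x)"
  shows "lin (\<lambda>x. lin_ext (\<lambda>(a, b). h a b x) p)"
  by (rule lin_lin_ext_param) (auto simp: assms split: prod.split)

lemma tens_bas [simp]: "tens (bas b) (bas c) = bas (b, c)"
  by (simp add: tens_def)

lemma lin_tens_left [lin_intros]: "lin f \<Longrightarrow> lin (\<lambda>x. tens (f x) q)"
  unfolding tens_def by (rule lin_lin_ext')

lemma lin_tens_right [lin_intros]: "lin f \<Longrightarrow> lin (\<lambda>x. tens p (f x))"
  unfolding tens_def by (rule lin_lin_ext_param) (rule lin_lin_ext')

lemma lin_comp: "lin g \<Longrightarrow> lin f \<Longrightarrow> lin (\<lambda>x. g (f x))"
  by (rule linI) (simp_all add: lin_add lin_smul)

lemma lin_tens1: "lin (\<lambda>p. tens p q)" and lin_tens2: "lin (tens p)"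
  by (intro lin_intros)+

lemmas tens_simps = lin_simps[OF lin_tens1] lin_simps[OF lin_tens2]

lemma lin_ext_tens:
  "lin_ext f (tens p q) = lin_ext (\<lambda>b. lin_ext (\<lambda>c. f (b, c)) q) p"
proof (rule lin_eqI[where f = "\<lambda>p. lin_ext f (tens p q)"])
  fix b show "lin_ext f (tens (bas b) q) = lin_ext (\<lambda>b. lin_ext (\<lambda>c. f (b, c)) q) (bas b)"
    by (rule lin_eqI[where p = q]) ((intro lin_intros)+, simp)
qed (intro lin_intros)+

lemma lin_map_tens [lin_intros]: "lin h \<Longrightarrow> lin (\<lambda>x. map_tens f g (h x))"
  unfolding map_tens_def by (intro lin_intros)

lemma map_tens_tens:
  assumes f: "lin f" and g: "lin g"
  shows "map_tens f g (tens p q) = tens (f p) (g q)"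
proof (rule lin_eqI[where f = "\<lambda>p. map_tens f g (tens p q)"])
  fix b show "map_tens f g (tens (bas b) q) = tens (f (bas b)) (g q)"
  proof (rule lin_eqI[where p = q])
    show "lin (\<lambda>q. tens (f (bas b)) (g q))" by (intro lin_intros g)
  qed (intro lin_intros, simp add: map_tens_def)
qed (intro lin_intros f)+

text \<open>The neutral element of the index monoid is written \<open>0\<close>, so
  \<open>single 0 c\<close> is c times the unit of the monoid algebra.\<close>

lemma smul_conv_mult: "smul c p = Poly_Mapping.single 0 c * p"
  unfolding smul_def by (rule mult_map_scale_conv_mult)

lemma smul_mult_left [simp]: "smul c p * q = smul c (p * q)"
  by (simp add: smul_conv_mult mult.assoc)

lemma bas_mult_bas: "bas u * bas v = bas (u + v)"
  by (simp add: mult_single)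

lemma smul_bas: "smul c (bas b) = Poly_Mapping.single b c"
  by (simp add: smul_def)

lemma mult_single_zero: "p * Poly_Mapping.single 0 c = smul c p"
proof (rule lin_eqI[where p = p])
  show "lin (\<lambda>p. p * Poly_Mapping.single 0 c)" by (rule linI) (simp_all add: distrib_right)
qed (intro lin_intros, simp add: mult_single smul_bas)

lemma smul_mult_right [simp]: "p * smul c q = smul c (p * q)"
  by (metis smul_conv_mult mult_single_zero mult.assoc)

lemma lin_times_left [lin_intros]: "lin f \<Longrightarrow> lin (\<lambda>x. f x * q)"
  by (rule linI) (auto simp: lin_add lin_smul distrib_right)

lemma lin_times_right [lin_intros]: "lin f \<Longrightarrow> lin (\<lambda>x. q * f x)"
  by (rule linI) (auto simp: lin_add lin_smul distrib_left)

lemma lin_mult_eqI: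
  assumes f: "lin f" and "\<And>u v. f (bas (u + v)) = f (bas u) * f (bas v)"
  shows "f (p * q) = f p * f q"
proof (rule lin_eqI[where p = p])
  fix u show "f (bas u * q) = f (bas u) * f q"
  proof (rule lin_eqI[where p = q])
    show "lin (\<lambda>q. f (bas u * q))" by (rule lin_comp[OF f], intro lin_intros)
    show "lin (\<lambda>q. f (bas u) * f q)" by (intro f lin_intros)
  qed (simp add: assms bas_mult_bas)
next
  show "lin (\<lambda>p. f (p * q))" by (rule lin_comp[OF f], intro lin_intros)
  show "lin (\<lambda>p. f p * f q)" by (intro f lin_intros)
qed

lemma tens_mult_tens: "tens p q * tens r s = tens (p * r) (q * s)"
proof (rule lin_eqI[where p = p])
  fix a show "tens (bas a) q * tens r s = tens (bas a * r) (q * s)"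
  proof (rule lin_eqI[where p = q])
    fix b show "tens (bas a) (bas b) * tens r s = tens (bas a * r) (bas b * s)"
    proof (rule lin_eqI[where p = r])
      fix c show "tens (bas a) (bas b) * tens (bas c) s = tens (bas a * bas c) (bas b * s)"
        by (rule lin_eqI[where p = s]) ((intro lin_intros)+, simp add: bas_mult_bas)
    qed (intro lin_intros)+
  qed (intro lin_intros)+
qed (intro lin_intros)+

section \<open>Congruences and ideals\<close>

lemma lin_span:
  assumes "lin f" "\<And>x. x \<in> S \<Longrightarrow> f x \<in> fs.span T" "x \<in> fs.span S"
  shows "f x \<in> fs.span T"
  using assms(3)
proof (induction rule: fs.span_induct_alt)
  case base
  show ?case by (simp add: lin_0[OF assms(1)] fs.span_zero)
next
  case (step c x y)
  then show ?case
    by (simp add: lin_add[OF assms(1)] lin_smul[OF assms(1)] assms(2) fs.span_add fs.span_scale)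
qed

text \<open>Equality in the quotient by the span of \<open>S\<close>. Taking the span here lets
  \<open>S\<close> be a set of generators, a relation space, or empty; the empty set gives plain
  equality.\<close>

definition eqm :: "('b \<Rightarrow>\<^sub>0 'k::field) set \<Rightarrow> ('b \<Rightarrow>\<^sub>0 'k) \<Rightarrow> ('b \<Rightarrow>\<^sub>0 'k) \<Rightarrow> bool" where
  "eqm S x y \<longleftrightarrow> x - y \<in> fs.span S"

lemma eqm_refl [simp]: "eqm S x x"
  by (simp add: eqm_def fs.span_zero)

lemma eqm_sym: "eqm S x y \<Longrightarrow> eqm S y x"
  using fs.span_neg[of "x - y" S] by (simp add: eqm_def)

lemma eqm_trans [trans]: "eqm S x y \<Longrightarrow> eqm S y z \<Longrightarrow> eqm S x z"
  using fs.span_add[of "x - y" S "y - z"] by (simp add: eqm_def)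

lemma eqm_add: "eqm S x y \<Longrightarrow> eqm S x' y' \<Longrightarrow> eqm S (x + x') (y + y')"
  using fs.span_add[of "x - y" S "x' - y'"] by (simp add: eqm_def algebra_simps)

lemma eqm_smul: "eqm S x y \<Longrightarrow> eqm S (smul c x) (smul c y)"
  using fs.span_scale[of "x - y" S c] by (simp add: eqm_def fs.scale_right_diff_distrib)

lemma eqm_lin:
  assumes "eqm S x y" "lin f" "\<And>x. x \<in> S \<Longrightarrow> f x \<in> fs.span T"
  shows "eqm T (f x) (f y)"
  using lin_span[of f S T "x - y"] assms by (simp add: eqm_def lin_diff)

definition ideal :: "('b::monoid_add \<Rightarrow>\<^sub>0 'k::field) set \<Rightarrow> bool" where
  "ideal S \<longleftrightarrow> (\<forall>x\<in>fs.span S. \<forall>u. u * x \<in> fs.span S \<and> x * u \<in> fs.span S)"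

lemma eqm_mult:
  assumes "ideal S" "eqm S x y" "eqm S x' y'"
  shows "eqm S (x * x') (y * y')"
proof -
  have "x * x' - y * y' = (x - y) * x' + y * (x' - y')"
    by (simp add: algebra_simps)
  then show ?thesis
    using assms by (simp add: eqm_def ideal_def fs.span_add)
qed

lemma eqm_power: "ideal S \<Longrightarrow> eqm S x y \<Longrightarrow> eqm S (x ^ m) (y ^ m)"
  by (induction m) (auto intro: eqm_mult)

lemma rel_tens_left: "r \<in> fs.span R \<Longrightarrow> tens r q \<in> rel_tens R S"
  unfolding rel_tens_def
  by (rule lin_span[OF lin_tens1], rule fs.span_base) auto

lemma rel_tens_right: "s \<in> fs.span S \<Longrightarrow> tens p s \<in> rel_tens R S"
  unfolding rel_tens_def
  by (rule lin_span[OF lin_tens2], rule fs.span_base) auto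

lemma span_rel_tens [simp]: "fs.span (rel_tens R S) = rel_tens R S"
  by (simp add: rel_tens_def)

text \<open>The standard way to show that a map descends to a tensor product of quotients: it is
  checked on pure tensors with one factor a relation.\<close>

lemma lin_rel_tens:
  assumes "x \<in> rel_tens R S" "lin f"
    "\<And>r q. r \<in> R \<Longrightarrow> f (tens r q) \<in> fs.span T" "\<And>p s. s \<in> S \<Longrightarrow> f (tens p s) \<in> fs.span T"
  shows "f x \<in> fs.span T"
  using assms(1) unfolding rel_tens_def
  by (rule lin_span[OF assms(2), rotated]) (use assms(3,4) in auto)

lemma eqm_tens:
  assumes "eqm R p p'" "eqm S q q'"
  shows "eqm (rel_tens R S) (tens p q) (tens p' q')"
proof -
  have "tens p q - tens p' q' = tens (p - p') q + tens p' (q - q')"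
    by (simp add: tens_simps)
  then show ?thesis
    using assms fs.span_add[of _ "rel_tens R S"]
    by (simp add: eqm_def rel_tens_left rel_tens_right)
qed

lemma bas_pair_span: "lin f \<Longrightarrow> (\<And>a b. f (tens (bas a) (bas b)) \<in> fs.span T) \<Longrightarrow> f x \<in> fs.span T"
  by (subst poly_mapping_sum_bas)
    (auto simp: lin_sum lin_smul intro!: fs.span_sum fs.span_scale)

text \<open>Multiplication in the tensor product is factorwise, so a relation in either factor stays
  a relation there. This makes congruences in \<open>A \<otimes> A\<close> multiplicative.\<close>

lemma ideal_rel_tens:
  assumes "ideal R" "ideal S"
  shows "ideal (rel_tens R S)"
proof -
  have "u * x \<in> fs.span (rel_tens R S) \<and> x * u \<in> fs.span (rel_tens R S)"
    if x: "x \<in> rel_tens R S" for u x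
  proof (rule conjI; rule lin_rel_tens[OF x])
    have lr: "r * q \<in> fs.span R" "q * r \<in> fs.span R" if "r \<in> R" for r q
      using assms(1) fs.span_base[OF that] by (auto simp: ideal_def)
    have ls: "r * q \<in> fs.span S" "q * r \<in> fs.span S" if "r \<in> S" for r q
      using assms(2) fs.span_base[OF that] by (auto simp: ideal_def)
    show "lin ((*) u)" "lin (\<lambda>x. x * u)" by (intro lin_intros)+
    show "u * tens r q \<in> fs.span (rel_tens R S)" if "r \<in> R" for r q
      by (rule bas_pair_span[where x = u], intro lin_intros)
        (simp only: tens_mult_tens span_rel_tens rel_tens_left lr[OF that])
    show "u * tens p s \<in> fs.span (rel_tens R S)" if "s \<in> S" for p s
      by (rule bas_pair_span[where x = u], intro lin_intros)
        (simp only: tens_mult_tens span_rel_tens rel_tens_right ls[OF that])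
    show "tens r q * u \<in> fs.span (rel_tens R S)" if "r \<in> R" for r q
      by (rule bas_pair_span[where x = u], intro lin_intros)
        (simp only: tens_mult_tens span_rel_tens rel_tens_left lr[OF that])
    show "tens p s * u \<in> fs.span (rel_tens R S)" if "s \<in> S" for p s
      by (rule bas_pair_span[where x = u], intro lin_intros)
        (simp only: tens_mult_tens span_rel_tens rel_tens_right ls[OF that])
  qed
  then show ?thesis by (simp add: ideal_def)
qed

section \<open>Comultiplication and antipode on the free algebra\<close>

lemma bas_append: "bas (u @ v) = bas u * bas v"
  by (simp add: bas_mult_bas plus_list_def)

lemma bas_Nil: "bas [] = 1"
  by (simp add: zero_list_def flip: single_one)

lemma lin_comult: "lin \<Delta>"
  unfolding \<Delta>_def by (rule lin_lin_ext)

lemma comult_mult: "\<Delta> (p * q) = \<Delta> p * \<Delta> q"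
  by (rule lin_mult_eqI[OF lin_comult]) (simp add: \<Delta>_def plus_list_def)

lemma comult_1: "\<Delta> 1 = 1"
  by (simp add: \<Delta>_def flip: bas_Nil)

lemma comult_X: "\<Delta> (X i j) = tens (X i I1) (X I1 j) + tens (X i I2) (X I2 j)"
  by (simp add: \<Delta>_def X_def)

lemma lin_antipode: "lin (antipode N)"
  unfolding antipode_def by (rule lin_lin_ext)

lemma antipode_mult: "antipode N (p * q) = antipode N q * antipode N p"
proof (rule lin_eqI[where p = p])
  fix u show "antipode N (bas u * q) = antipode N q * antipode N (bas u)"
  proof (rule lin_eqI[where p = q])
    show "lin (\<lambda>q. antipode N (bas u * q))"
      by (rule lin_comp[OF lin_antipode], intro lin_intros)
    show "lin (\<lambda>q. antipode N q * antipode N (bas u))"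
      by (intro lin_intros lin_antipode)
  qed (simp add: bas_mult_bas antipode_def plus_list_def)
next
  show "lin (\<lambda>p. antipode N (p * q))"
    by (rule lin_comp[OF lin_antipode], intro lin_intros)
  show "lin (\<lambda>p. antipode N q * antipode N p)"
    by (intro lin_intros lin_antipode)
qed

lemma antipode_1: "antipode N 1 = 1"
  by (simp add: antipode_def flip: bas_Nil)

lemma antipode_X: "antipode N (X i j) = X j i ^ (4 * N - 1)"
  by (simp add: antipode_def X_def)

section \<open>Words of one sign in the Suzuki algebra\<close>

definition ltr :: "bool \<Rightarrow> idx \<Rightarrow> idx \<times> idx" where
  "ltr s i = (i, if s then other i else i)"

definition wd :: "bool \<Rightarrow> idx list \<Rightarrow> 'k::field free_alg" where
  "wd s ws = bas (map (ltr s) ws)"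

lemma other_other [simp]: "other (other i) = i"
  by (cases i) auto

lemma other_neq [simp]: "other i \<noteq> i" "i \<noteq> other i"
  by (cases i; simp)+

lemma wd_append: "wd s (u @ v) = wd s u * wd s v"
  by (simp add: wd_def bas_append)

lemma wd_Nil [simp]: "wd s [] = 1"
  by (simp add: wd_def bas_Nil)

lemma wd_Cons: "wd s (i # v) = wd s [i] * wd s v"
  using wd_append[of s "[i]" v] by simp

lemma X_conv_wd: "X i j = wd (i \<noteq> j) [i]"
  by (cases i; cases j) (simp_all add: X_def wd_def ltr_def)

lemma wd_conv_X: "wd s [i] = X i (if s then other i else i)"
  by (simp add: X_def wd_def ltr_def)

fun alt :: "idx \<Rightarrow> nat \<Rightarrow> idx list" where
  "alt i 0 = []"
| "alt i (Suc m) = i # alt (other i) m"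

lemma alt_snoc: "alt i (Suc m) = alt i m @ [if even m then i else other i]"
proof (induction m arbitrary: i)
  case (Suc m)
  have "alt i (Suc (Suc m)) = i # alt (other i) (Suc m)" by simp
  also have "\<dots> = i # alt (other i) m @ [if even m then other i else i]"
    by (simp only: Suc other_other)
  finally show ?case by simp
qed simp

lemma rev_alt: "rev (alt i m) = alt (if even m then other i else i) m"
proof (induction m arbitrary: i)
  case (Suc m)
  then show ?case by (subst alt_snoc) auto
qed simp

lemma map_other_alt: "map other (alt i m) = alt (other i) m"
  by (induction m arbitrary: i) auto

lemma length_alt [simp]: "length (alt i m) = m"
  by (induction m arbitrary: i) auto

text \<open>Passing to the next factor exchanges both indices, so the sign
  \<open>i \<noteq> j\<close> persists along the alternating product.\<close>

lemma chi_conv_wd: "(chi i j m :: 'k::field free_alg) = wd (i \<noteq> j) (alt i m)"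
proof (induction m arbitrary: i j)
  case (Suc m)
  have "other i \<noteq> other j \<longleftrightarrow> i \<noteq> j"
    by (cases i; cases j; simp)
  then have "chi (other i) (other j) m = (wd (i \<noteq> j) (alt (other i) m) :: 'k free_alg)"
    by (simp add: Suc)
  then show ?case
    by (simp add: chi_def X_conv_wd wd_Cons[of _ i "alt _ _"])
qed (simp add: chi_def)

lemma wd_replicate: "wd s (replicate m i) = wd s [i] ^ m"
  by (induction m) (simp_all add: wd_Cons[of s i "replicate _ _"])

text \<open>The index \<open>i\<close> selects the words in w_1 or w_2, and the sign given to
  \<open>wd\<close> selects the first or second summand. For \<open>I1\<close> the first letter of
  the alternating part joins the power of index 1, which produces the exponent 2m+1.\<close>

definition G_word :: "nat \<Rightarrow> nat \<Rightarrow> idx \<Rightarrow> idx list" where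
  "G_word m t i = replicate (2 * m) I1 @ alt i (2 * t + 1)"

lemma G_word_neq_Nil [simp]: "G_word m t i \<noteq> []"
  by (simp add: G_word_def)

section \<open>Relations between words of one sign\<close>

locale suzuki =
  fixes N n :: nat and \<mu> lam :: "'k::field"
  assumes N_pos: "0 < N" and n_pos: "0 < n"
    and mu_square: "\<mu> * \<mu> = 1" and lam_square: "lam * lam = 1"
begin

abbreviation "SI \<equiv> suzuki_ideal N n \<mu> lam"

abbreviation eqI (infix "\<sim>" 50) where "x \<sim> y \<equiv> eqm SI x y"

text \<open>This is x_11^2 or x_12^2, according to the sign; modulo the ideal it commutes with the
  words of its own sign.\<close>

abbreviation z :: "bool \<Rightarrow> 'k free_alg" where "z s \<equiv> wd s [I1, I1]"

lemma span_SI [simp]: "fs.span SI = SI"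
  by (simp add: suzuki_ideal_def)

lemma ideal_SI: "ideal SI"
proof -
  let ?G = "{u * r * v |u r v. r \<in> suzuki_relators N n \<mu> lam}"
  have G: "a * r * b \<in> fs.span ?G" if "r \<in> suzuki_relators N n \<mu> lam" for a r b
    using that by (intro fs.span_base) blast
  have "u * x \<in> fs.span ?G" if "x \<in> fs.span ?G" for u x
  proof (rule lin_span[OF _ _ that])
    show "lin ((*) u)" by (intro lin_intros)
    fix y assume "y \<in> ?G"
    then obtain a r b where y: "y = a * r * b" "r \<in> suzuki_relators N n \<mu> lam" by blast
    show "u * y \<in> fs.span ?G"
      using G[OF y(2), of "u * a" b] by (simp add: y(1) mult.assoc)
  qed
  moreover have "x * u \<in> fs.span ?G" if "x \<in> fs.span ?G" for u x
  proof (rule lin_span[OF _ _ that])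
    show "lin (\<lambda>x. x * u)" by (intro lin_intros)
    fix y assume "y \<in> ?G"
    then obtain a r b where y: "y = a * r * b" "r \<in> suzuki_relators N n \<mu> lam" by blast
    show "y * u \<in> fs.span ?G"
      using G[OF y(2), of a "b * u"] by (simp add: y(1) mult.assoc)
  qed
  ultimately show ?thesis unfolding ideal_def suzuki_ideal_def fs.span_span by blast
qed

lemmas eqI_mult = eqm_mult[OF ideal_SI] and eqI_power = eqm_power[OF ideal_SI]

lemma relator_eqI: "x - y \<in> suzuki_relators N n \<mu> lam \<Longrightarrow> x \<sim> y"
proof -
  assume "x - y \<in> suzuki_relators N n \<mu> lam"
  then have "1 * (x - y) * 1 \<in> SI"
    unfolding suzuki_ideal_def by (intro fs.span_base) blast
  then show "x \<sim> y" by (simp add: eqm_def)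
qed

text \<open>One scalar for the two relations between alternating products of length 2n, so that both
  signs are treated together.\<close>

definition alt_scalar :: "bool \<Rightarrow> 'k" where "alt_scalar s = (if s then lam else 1)"

lemma alt_scalar_mult [simp]: "alt_scalar s * alt_scalar s = 1" "lam * alt_scalar (\<not> s) = alt_scalar s"
  "alt_scalar s * (alt_scalar s * x) = x"
  by (auto simp: alt_scalar_def lam_square simp flip: mult.assoc)

text \<open>In this form every relation except the unit relation concerns either one sign or the
  junction of two signs, which is how all later verifications are organised.\<close>

lemma wd_relators:
  "suzuki_relators N n \<mu> lam =
     {wd s [I1, I1] - wd s [I2, I2] |s. True}
     \<union> {wd False (alt I1 (2 * n)) - wd False (alt I2 (2 * n)),
        wd True (alt I2 (2 * n)) - smul lam (wd True (alt I1 (2 * n))),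
        wd False (replicate (2 * N) I1) + smul \<mu> (wd True (replicate (2 * N) I1)) - 1}
     \<union> {wd s [i] * wd (\<not> s) [j] |s i j. True}"
proof -
  have 1: "{X i j * X k l |i j k l. odd (ix i + ix j + ix k + ix l)} =
      {wd s [i] * wd (\<not> s) [j] |s i j. True }"
  proof -
    \<comment> \<open>The sum of the two indices of a letter is odd exactly when the letter is
      off-diagonal, so an odd total means that the two letters have opposite signs.\<close>
    have odd: "odd (ix i + ix j + ix k + ix l) \<longleftrightarrow> (k \<noteq> l) = (\<not> i \<noteq> j)" for i j k l
      by (cases i; cases j; cases k; cases l) auto
    have "X i j * X k l \<in> {wd s [i] * wd (\<not> s) [j] |s i j. True}"
      if "odd (ix i + ix j + ix k + ix l)" for i j k l
    proof -
      have "X i j * X k l = wd (i \<noteq> j) [i] * wd (\<not> i \<noteq> j) [k]"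
        using that unfolding odd by (simp only: X_conv_wd)
      then show ?thesis by blast
    qed
    moreover have "wd s [i] * wd (\<not> s) [k]
        \<in> {X i j * X k l |i j k l. odd (ix i + ix j + ix k + ix l)}" for s i k
    proof -
      have "wd s [i] * wd (\<not> s) [k]
          = X i (if s then other i else i) * X k (if \<not> s then other k else k)"
        by (simp only: wd_conv_X)
      moreover have "odd (ix i + ix (if s then other i else i) + ix k + ix (if \<not> s then other k else k))"
        unfolding odd by auto
      ultimately show ?thesis by blast
    qed
    ultimately show ?thesis by blast
  qed
  have 2: "X I1 I1 ^ 2 = wd False [I1, I1]" "X I2 I2 ^ 2 = wd False [I2, I2]"
    "X I1 I2 ^ 2 = wd True [I1, I1]" "X I2 I1 ^ 2 = wd True [I2, I2]"
    by (simp_all add: X_conv_wd power2_eq_square flip: wd_append)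
  have 3: "X I1 I1 ^ m = wd False (replicate m I1)" "X I1 I2 ^ m = wd True (replicate m I1)" for m
    by (simp_all add: X_conv_wd wd_replicate)
  have 4: "{wd s [I1, I1] - wd s [I2, I2] |s. True}
      = {wd False [I1, I1] - wd False [I2, I2], wd True [I1, I1] - wd True [I2, I2]}"
    by (auto simp: ex_bool_eq)
  have "suzuki_relators N n \<mu> lam =
     {wd False [I1, I1] - wd False [I2, I2], wd True [I1, I1] - wd True [I2, I2],
      wd True (alt I2 (2 * n)) - smul lam (wd True (alt I1 (2 * n))),
      wd False (alt I1 (2 * n)) - wd False (alt I2 (2 * n)),
      wd False (replicate (2 * N) I1) + smul \<mu> (wd True (replicate (2 * N) I1)) - 1}
     \<union> {wd s [i] * wd (\<not> s) [j] |s i j. True}"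
    unfolding suzuki_relators_def 1 2 by (simp add: 3 chi_conv_wd)
  then show ?thesis
    unfolding 4 by blast
qed

lemma wd_square_eqI: "wd s [i, i] \<sim> z s"
proof (cases i)
  case I2
  have "z s \<sim> wd s [I2, I2]"
    by (rule relator_eqI) (auto simp: wd_relators)
  then show ?thesis using I2 by (auto intro: eqm_sym)
qed simp

lemma wd_alt_eqI: "wd s (alt I2 (2 * n)) \<sim> smul (alt_scalar s) (wd s (alt I1 (2 * n)))"
proof (cases s)
  case True
  then show ?thesis by (intro relator_eqI) (auto simp: wd_relators alt_scalar_def)
next
  case False
  have "wd False (alt I1 (2 * n)) \<sim> wd False (alt I2 (2 * n))"
    by (intro relator_eqI) (auto simp: wd_relators)
  then show ?thesis using False by (simp add: alt_scalar_def eqm_sym)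
qed

lemma wd_unit_eqI:
  "wd False (replicate (2 * N) I1) + smul \<mu> (wd True (replicate (2 * N) I1)) \<sim> 1"
  by (intro relator_eqI) (auto simp: wd_relators)

lemma wd_mixed_letters: "wd s [i] * wd (\<not> s) [j] \<sim> 0"
  by (rule relator_eqI) (auto simp: wd_relators)

text \<open>The product vanishes at the junction, between the last letter of \<open>u\<close> and
  the first letter of \<open>v\<close>; both must therefore be nonempty.\<close>

lemma wd_mixed:
  assumes "u \<noteq> []" "v \<noteq> []"
  shows "wd s u * wd (\<not> s) v \<sim> 0"
proof -
  have u: "u = butlast u @ [last u]" and v: "v = hd v # tl v"
    using assms by auto
  have "wd s u * wd (\<not> s) v
      = wd s (butlast u) * ((wd s [last u] * wd (\<not> s) [hd v]) * wd (\<not> s) (tl v))"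
    by (subst u, subst v) (simp only: wd_append wd_Cons[of _ _ "tl v"] mult.assoc)
  also have "\<dots> \<sim> wd s (butlast u) * (0 * wd (\<not> s) (tl v))"
    by (intro eqI_mult eqm_refl wd_mixed_letters)
  finally show ?thesis by simp
qed

lemma wd_mixed': "s \<noteq> s' \<Longrightarrow> u \<noteq> [] \<Longrightarrow> v \<noteq> [] \<Longrightarrow> wd s u * wd s' v \<sim> 0"
  using wd_mixed[of u v s] by (cases s; cases s') auto

text \<open>The square of each letter of sign \<open>s\<close> is congruent to \<open>z s\<close>,
  so passing one letter is the associativity of its cube.\<close>

lemma z_central: "z s * wd s ws \<sim> wd s ws * z s"
proof (induction ws)
  case (Cons i ws)
  have "z s * wd s (i # ws) = (z s * wd s [i]) * wd s ws"
    by (simp add: wd_Cons[of s i ws] mult.assoc)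
  also have "\<dots> \<sim> (wd s [i, i] * wd s [i]) * wd s ws"
    by (intro eqI_mult eqm_refl eqm_sym[OF wd_square_eqI])
  also have "\<dots> = wd s [i] * wd s [i, i] * wd s ws"
    by (simp flip: wd_append)
  also have "\<dots> \<sim> wd s [i] * z s * wd s ws"
    by (intro eqI_mult eqm_refl wd_square_eqI)
  also have "\<dots> = wd s [i] * (z s * wd s ws)" by (simp add: mult.assoc)
  also have "\<dots> \<sim> wd s [i] * (wd s ws * z s)"
    by (intro eqI_mult eqm_refl Cons)
  also have "\<dots> = wd s (i # ws) * z s"
    by (simp add: wd_Cons[of s i ws] mult.assoc)
  finally show ?case .
qed simp

lemma z_power_central: "wd s ws * z s ^ m \<sim> z s ^ m * wd s ws"
proof (induction m)
  case (Suc m)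
  have "wd s ws * z s ^ Suc m = (wd s ws * z s) * z s ^ m" by (simp add: mult.assoc)
  also have "\<dots> \<sim> (z s * wd s ws) * z s ^ m"
    by (intro eqI_mult eqm_refl eqm_sym[OF z_central])
  also have "\<dots> = z s * (wd s ws * z s ^ m)" by (simp add: mult.assoc)
  also have "\<dots> \<sim> z s * (z s ^ m * wd s ws)"
    by (intro eqI_mult eqm_refl Suc)
  finally show ?case by (simp add: mult.assoc)
qed simp

lemma wd_replicate_eqI: "wd s (replicate (2 * m) i) \<sim> z s ^ m"
proof -
  have "wd s (replicate (2 * m) i) = wd s [i, i] ^ m"
    by (simp add: wd_replicate power_mult wd_Cons[of s i "[i]"] power2_eq_square)
  also have "\<dots> \<sim> z s ^ m" by (intro eqI_power wd_square_eqI)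
  finally show ?thesis .
qed

text \<open>Multiplying the unit relation by a nonempty word of sign \<open>s\<close> kills the
  summand of the other sign. What remains is that \<nu> z^N fixes the word, where \<nu> is 1 or
  \<mu>; applying this twice removes \<nu> because \<nu>^2 = 1.\<close>

lemma z_power_absorb:
  assumes "ws \<noteq> []"
  shows "z s ^ (2 * N) * wd s ws \<sim> wd s ws"
proof -
  let ?F = "wd False (replicate (2 * N) I1)" and ?T = "wd True (replicate (2 * N) I1)"
  have rep: "replicate (2 * N) I1 \<noteq> []" using N_pos by simp
  have unit: "(?F + smul \<mu> ?T) * wd s ws \<sim> wd s ws"
    using eqI_mult[OF wd_unit_eqI eqm_refl, of "wd s ws"] by simp
  define \<nu> where "\<nu> = (if s then \<mu> else 1)"
  have nu: "\<nu> * \<nu> = 1" by (simp add: \<nu>_def mu_square)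
  have "smul \<nu> (wd s (replicate (2 * N) I1) * wd s ws) \<sim> wd s ws"
  proof (cases s)
    case True
    have "0 + smul \<mu> (?T * wd s ws) \<sim> ?F * wd s ws + smul \<mu> (?T * wd s ws)"
      using True assms rep by (intro eqm_add eqm_refl eqm_sym[OF wd_mixed']) auto
    also have "\<dots> \<sim> wd s ws" using unit by (simp add: distrib_right)
    finally show ?thesis using True by (simp add: \<nu>_def)
  next
    case False
    have "?F * wd s ws + smul \<mu> 0 \<sim> ?F * wd s ws + smul \<mu> (?T * wd s ws)"
      using False assms rep by (intro eqm_add eqm_refl eqm_smul eqm_sym[OF wd_mixed']) auto
    also have "\<dots> \<sim> wd s ws" using unit by (simp add: distrib_right)
    finally show ?thesis using False by (simp add: \<nu>_def)
  qed
  moreover have "smul \<nu> (z s ^ N * wd s ws) \<sim> smul \<nu> (wd s (replicate (2 * N) I1) * wd s ws)"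
    by (intro eqm_smul eqI_mult eqm_refl eqm_sym[OF wd_replicate_eqI])
  ultimately have *: "smul \<nu> (z s ^ N * wd s ws) \<sim> wd s ws"
    by (rule eqm_trans[rotated])
  have "z s ^ (2 * N) * wd s ws = smul \<nu> (z s ^ N * smul \<nu> (z s ^ N * wd s ws))"
    by (simp add: nu mult_2 power_add mult.assoc)
  also have "\<dots> \<sim> smul \<nu> (z s ^ N * wd s ws)"
    by (intro eqm_smul eqI_mult eqm_refl *)
  also note *
  finally show ?thesis .
qed

lemma z_power_absorb_mult:
  assumes "ws \<noteq> []"
  shows "z s ^ (2 * N * m) * wd s ws \<sim> wd s ws"
proof (induction m)
  case (Suc m)
  have "z s ^ (2 * N * Suc m) * wd s ws = z s ^ (2 * N * m) * (z s ^ (2 * N) * wd s ws)"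
    by (simp only: mult_Suc_right add.commute[of "2 * N"] power_add mult.assoc)
  also have "\<dots> \<sim> z s ^ (2 * N * m) * wd s ws"
    by (intro eqI_mult eqm_refl z_power_absorb assms)
  also note Suc
  finally show ?case .
qed simp

text \<open>The antipode exponent is 4N-1 = 2(2N-1)+1: all letters but one pair up into
  squares.\<close>

lemma wd_letter_power: "wd s [i] ^ (4 * N - 1) \<sim> z s ^ (2 * N - 1) * wd s [i]"
proof -
  have "4 * N - 1 = Suc (2 * (2 * N - 1))" using N_pos by simp
  then have "wd s [i] ^ (4 * N - 1) = wd s (replicate (2 * (2 * N - 1)) i) * wd s [i]"
    by (simp add: wd_replicate power_commutes)
  also have "\<dots> \<sim> z s ^ (2 * N - 1) * wd s [i]"
    by (intro eqI_mult eqm_refl wd_replicate_eqI)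
  finally show ?thesis .
qed

section \<open>Comultiplication on the Suzuki algebra\<close>

abbreviation "SI2 \<equiv> rel_tens SI SI"

lemma tens_1_1: "tens 1 1 = 1"
  by (simp add: zero_prod_def flip: single_one)

lemma ideal_SI2: "ideal SI2"
  by (intro ideal_rel_tens ideal_SI)

lemmas eq2_mult = eqm_mult[OF ideal_SI2]

lemma comult_letter:
  "\<Delta> (wd s [i]) = tens (wd False [i]) (wd s [i]) + tens (wd True [i]) (wd (\<not> s) [other i])"
  by (cases i; cases s) (simp_all add: wd_conv_X comult_X add.commute)

lemma comult_wd:
  "ws \<noteq> [] \<Longrightarrow> eqm SI2 (\<Delta> (wd s ws))
     (tens (wd False ws) (wd s ws) + tens (wd True ws) (wd (\<not> s) (map other ws)))"
proof (induction ws rule: list_nonempty_induct)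
  case (single i)
  then show ?case by (simp add: comult_letter)
next
  case (cons i ws)
  let ?L = "\<lambda>s. wd s [i]" and ?L' = "\<lambda>s. wd s [other i]"
    and ?W = "\<lambda>s. wd s ws" and ?W' = "\<lambda>s. wd s (map other ws)"
  have "\<Delta> (wd s (i # ws)) = \<Delta> (?L s) * \<Delta> (?W s)"
    by (simp add: wd_Cons[of s i ws] comult_mult)
  also have "eqm SI2 \<dots> (\<Delta> (?L s) * (tens (?W False) (?W s) + tens (?W True) (?W' (\<not> s))))"
    by (intro eq2_mult eqm_refl cons)
  also have "\<Delta> (?L s) * (tens (?W False) (?W s) + tens (?W True) (?W' (\<not> s)))
     = (tens (?L False * ?W False) (?L s * ?W s) + tens (?L False * ?W True) (?L s * ?W' (\<not> s)))
       + (tens (?L True * ?W False) (?L' (\<not> s) * ?W s) + tens (?L True * ?W True) (?L' (\<not> s) * ?W' (\<not> s)))"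
    by (simp add: comult_letter tens_mult_tens distrib_left distrib_right add_ac)
  \<comment> \<open>The two cross terms have a first tensor factor of mixed sign.\<close>
  also have "eqm SI2 \<dots> ((tens (?L False * ?W False) (?L s * ?W s) + tens 0 (?L s * ?W' (\<not> s)))
       + (tens 0 (?L' (\<not> s) * ?W s) + tens (?L True * ?W True) (?L' (\<not> s) * ?W' (\<not> s))))"
    using cons.hyps by (intro eqm_add eqm_tens eqm_refl wd_mixed') auto
  also have "\<dots> = tens (wd False (i # ws)) (wd s (i # ws))
      + tens (wd True (i # ws)) (wd (\<not> s) (map other (i # ws)))"
    by (simp add: tens_simps wd_Cons[of _ i ws] wd_Cons[of _ "other i" "map other ws"])
  finally show ?case .
qed

lemma alt_n_neq_Nil: "alt i (2 * n) \<noteq> []"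
  using n_pos by (metis length_alt list.size(3) mult_is_0 neq0_conv zero_neq_numeral)

lemma wd_alt_eqI': "wd s (alt I1 (2 * n)) \<sim> smul (alt_scalar s) (wd s (alt I2 (2 * n)))"
  using eqm_smul[OF eqm_sym[OF wd_alt_eqI], of "alt_scalar s" s] by simp

lemma comult_relator:
  assumes "r \<in> suzuki_relators N n \<mu> lam"
  shows "eqm SI2 (\<Delta> r) 0"
proof -
  have diff: "eqm SI2 (\<Delta> (x - y)) 0" if "eqm SI2 (\<Delta> x) (\<Delta> y)" for x y
    using that by (simp add: eqm_def lin_diff[OF lin_comult])
  have sq: "eqm SI2 (\<Delta> (wd s [I1, I1])) (\<Delta> (wd s [I2, I2]))" for s
  proof -
    have "eqm SI2 (\<Delta> (wd s [I1, I1]))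
        (tens (wd False [I1, I1]) (wd s [I1, I1]) + tens (wd True [I1, I1]) (wd (\<not> s) [I2, I2]))"
      using comult_wd[of "[I1, I1]" s] by simp
    also have "eqm SI2 \<dots>
        (tens (wd False [I2, I2]) (wd s [I2, I2]) + tens (wd True [I2, I2]) (wd (\<not> s) [I1, I1]))"
      by (intro eqm_add eqm_tens wd_square_eqI eqm_sym[OF wd_square_eqI])
    also have "eqm SI2 \<dots> (\<Delta> (wd s [I2, I2]))"
      using comult_wd[of "[I2, I2]" s] by (simp add: eqm_sym)
    finally show ?thesis .
  qed
  have alt: "eqm SI2 (\<Delta> (wd s (alt I2 (2 * n)))) (\<Delta> (smul (alt_scalar s) (wd s (alt I1 (2 * n)))))" for s
  proof -
    let ?A = "\<lambda>i s. wd s (alt i (2 * n))"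
    have cm: "eqm SI2 (\<Delta> (?A i s)) (tens (?A i False) (?A i s) + tens (?A i True) (?A (other i) (\<not> s)))" for i
      using comult_wd[OF alt_n_neq_Nil[of i], of s] by (simp add: map_other_alt)
    have "eqm SI2 (\<Delta> (?A I2 s)) (tens (?A I2 False) (?A I2 s) + tens (?A I2 True) (?A I1 (\<not> s)))"
      using cm[of I2] by simp
    \<comment> \<open>In the second summand the right factor uses the relation in the opposite
      direction. Both summands still acquire the same scalar, because
      \<open>lam * alt_scalar (\<not> s) = alt_scalar s\<close>.\<close>
    also have "eqm SI2 \<dots> (tens (smul (alt_scalar False) (?A I1 False)) (smul (alt_scalar s) (?A I1 s))
        + tens (smul (alt_scalar True) (?A I1 True)) (smul (alt_scalar (\<not> s)) (?A I2 (\<not> s))))"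
      by (intro eqm_add eqm_tens wd_alt_eqI wd_alt_eqI')
    also have "\<dots> = smul (alt_scalar s) (tens (?A I1 False) (?A I1 s) + tens (?A I1 True) (?A (other I1) (\<not> s)))"
      by (simp add: tens_simps fs.scale_right_distrib) (simp add: alt_scalar_def lam_square)
    also have "eqm SI2 \<dots> (smul (alt_scalar s) (\<Delta> (?A I1 s)))"
      by (intro eqm_smul eqm_sym[OF cm])
    finally show ?thesis by (simp add: lin_smul[OF lin_comult])
  qed
  have unit: "eqm SI2 (\<Delta> (wd False (replicate (2 * N) I1) + smul \<mu> (wd True (replicate (2 * N) I1)))) (\<Delta> 1)"
  proof -
    let ?Z = "\<lambda>s. wd s (replicate (2 * N) I1)"
    have "?Z s \<sim> wd s (replicate (2 * N) I2)" for s
      using wd_replicate_eqI eqm_sym[OF wd_replicate_eqI] by (rule eqm_trans)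
    then have Z': "wd s (replicate (2 * N) I2) \<sim> ?Z s" for s by (rule eqm_sym)
    have cm: "eqm SI2 (\<Delta> (?Z s)) (tens (?Z False) (?Z s) + tens (?Z True) (?Z (\<not> s)))" for s
    proof -
      have "eqm SI2 (\<Delta> (?Z s)) (tens (?Z False) (?Z s) + tens (?Z True) (wd (\<not> s) (replicate (2 * N) I2)))"
        using comult_wd[of "replicate (2 * N) I1" s] N_pos by simp
      also have "eqm SI2 \<dots> (tens (?Z False) (?Z s) + tens (?Z True) (?Z (\<not> s)))"
        by (intro eqm_add eqm_tens eqm_refl Z')
      finally show ?thesis .
    qed
    have "eqm SI2 (\<Delta> (?Z False) + smul \<mu> (\<Delta> (?Z True)))
       ((tens (?Z False) (?Z False) + tens (?Z True) (?Z True))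
         + smul \<mu> (tens (?Z False) (?Z True) + tens (?Z True) (?Z False)))"
      using cm[of True] cm[of False] by (intro eqm_add eqm_smul) simp_all
    \<comment> \<open>Since \<mu>^2 = 1, the four terms can be grouped by their left factor so that
      the unit relation appears on the right; afterwards it appears on the left.\<close>
    also have "\<dots> = tens (?Z False) (?Z False + smul \<mu> (?Z True))
        + smul \<mu> (tens (?Z True) (?Z False + smul \<mu> (?Z True)))"
      by (simp add: tens_simps fs.scale_right_distrib mu_square algebra_simps)
    also have "eqm SI2 \<dots> (tens (?Z False) 1 + smul \<mu> (tens (?Z True) 1))"
      by (intro eqm_add eqm_smul eqm_tens eqm_refl wd_unit_eqI)
    also have "\<dots> = tens (?Z False + smul \<mu> (?Z True)) 1"
      by (simp add: tens_simps)
    also have "eqm SI2 \<dots> (tens 1 1)"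
      by (intro eqm_tens eqm_refl wd_unit_eqI)
    also have "tens 1 1 = (\<Delta> 1 :: (word \<times> word \<Rightarrow>\<^sub>0 'k))"
      by (simp add: comult_1 tens_1_1)
    finally show ?thesis by (simp add: lin_add[OF lin_comult] lin_smul[OF lin_comult])
  qed
  have mix: "eqm SI2 (\<Delta> (wd s [i] * wd (\<not> s) [j])) 0" for s i j
  proof -
    have 1: "\<Delta> (wd s [i] * wd (\<not> s) [j]) =
       (tens (wd False [i] * wd False [j]) (wd s [i] * wd (\<not> s) [j])
         + tens (wd False [i] * wd True [j]) (wd s [i] * wd s [other j]))
       + (tens (wd True [i] * wd False [j]) (wd (\<not> s) [other i] * wd (\<not> s) [j])
         + tens (wd True [i] * wd True [j]) (wd (\<not> s) [other i] * wd s [other j]))"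
      by (simp add: comult_mult comult_letter tens_mult_tens distrib_left distrib_right add_ac)
    have "eqm SI2 (\<Delta> (wd s [i] * wd (\<not> s) [j])) ((tens (wd False [i] * wd False [j]) 0
         + tens 0 (wd s [i] * wd s [other j]))
       + (tens 0 (wd (\<not> s) [other i] * wd (\<not> s) [j])
         + tens (wd True [i] * wd True [j]) 0))"
      unfolding 1 by (intro eqm_add eqm_tens eqm_refl wd_mixed') auto
    then show ?thesis by (simp only: tens_simps add_0)
  qed
  have "eqm SI2 (\<Delta> (wd True (alt I2 (2 * n)))) (\<Delta> (smul lam (wd True (alt I1 (2 * n)))))"
    using alt[of True] by (simp add: alt_scalar_def)
  moreover have "eqm SI2 (\<Delta> (wd False (alt I1 (2 * n)))) (\<Delta> (wd False (alt I2 (2 * n))))"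
    using eqm_sym[OF alt[of False]] by (simp add: alt_scalar_def)
  ultimately show ?thesis
    using assms unfolding wd_relators
    by (elim UnE insertE CollectE exE conjE emptyE)
      (simp_all only: diff sq unit mix)
qed

lemma comult_ideal: "x \<in> SI \<Longrightarrow> \<Delta> x \<in> SI2"
proof -
  assume "x \<in> SI"
  then have "\<Delta> x \<in> fs.span SI2"
    unfolding suzuki_ideal_def
  proof (rule lin_span[OF lin_comult, rotated], safe)
    fix u r v assume "r \<in> suzuki_relators N n \<mu> lam"
    then have "eqm SI2 (\<Delta> u * \<Delta> r * \<Delta> v) (\<Delta> u * 0 * \<Delta> v)"
      by (intro eq2_mult eqm_refl comult_relator)
    then show "\<Delta> (u * r * v) \<in> fs.span (rel_tens (fs.span {u * r * v |u r v. r \<in> suzuki_relators N n \<mu> lam})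
       (fs.span {u * r * v |u r v. r \<in> suzuki_relators N n \<mu> lam}))"
      by (simp add: comult_mult eqm_def suzuki_ideal_def)
  qed
  then show ?thesis by simp
qed

section \<open>Antipode on the Suzuki algebra\<close>

lemma antipode_letter: "antipode N (wd s [i]) = wd s [if s then other i else i] ^ (4 * N - 1)"
  by (cases i; cases s) (simp_all add: wd_conv_X antipode_X)

abbreviation swap_if :: "bool \<Rightarrow> idx \<Rightarrow> idx" where "swap_if s i \<equiv> if s then other i else i"

text \<open>Transposing a letter exchanges its indices when it is off-diagonal, and the word is
  reversed. Each letter contributes a factor z^(2N-1), moved to the front by centrality.\<close>

lemma antipode_wd:
  "antipode N (wd s ws) \<sim> z s ^ ((2 * N - 1) * length ws) * wd s (rev (map (swap_if s) ws))"
proof (induction ws)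
  case (Cons i ws)
  let ?m = "(2 * N - 1) * length ws" and ?r = "rev (map (swap_if s) ws)"
  have "antipode N (wd s (i # ws)) = antipode N (wd s ws) * antipode N (wd s [i])"
    by (simp add: wd_Cons[of s i ws] antipode_mult)
  also have "\<dots> \<sim> (z s ^ ?m * wd s ?r) * (z s ^ (2 * N - 1) * wd s [swap_if s i])"
    unfolding antipode_letter by (intro eqI_mult Cons wd_letter_power)
  also have "\<dots> = z s ^ ?m * (wd s ?r * z s ^ (2 * N - 1)) * wd s [swap_if s i]"
    by (simp add: mult.assoc)
  also have "\<dots> \<sim> z s ^ ?m * (z s ^ (2 * N - 1) * wd s ?r) * wd s [swap_if s i]"
    by (intro eqI_mult eqm_refl z_power_central)
  also have "\<dots> = z s ^ (?m + (2 * N - 1)) * wd s (?r @ [swap_if s i])"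
    by (simp add: mult.assoc power_add wd_append)
  also have "\<dots> = z s ^ ((2 * N - 1) * length (i # ws)) * wd s (rev (map (swap_if s) (i # ws)))"
    by (simp add: add.commute)
  finally show ?case .
qed (simp add: antipode_1)

lemma antipode_relator:
  assumes "r \<in> suzuki_relators N n \<mu> lam"
  shows "antipode N r \<sim> 0"
proof -
  have diff: "antipode N (x - y) \<sim> 0" if "antipode N x \<sim> antipode N y" for x y
    using that by (simp add: eqm_def lin_diff[OF lin_antipode])
  have sq: "antipode N (wd s [I1, I1]) \<sim> antipode N (wd s [I2, I2])" for s
  proof -
    have 1: "antipode N (wd s [i, i]) \<sim> z s ^ ((2 * N - 1) * 2) * z s" for i
    proof -
      have "antipode N (wd s [i, i]) \<sim> z s ^ ((2 * N - 1) * 2) * wd s [swap_if s i, swap_if s i]"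
        using antipode_wd[of s "[i, i]"] by (cases s) (simp_all add: mult_2_right)
      also have "\<dots> \<sim> z s ^ ((2 * N - 1) * 2) * z s"
        by (intro eqI_mult eqm_refl wd_square_eqI)
      finally show ?thesis .
    qed
    show ?thesis by (rule eqm_trans[OF 1 eqm_sym[OF 1]])
  qed
  have alt: "antipode N (wd s (alt I2 (2 * n))) \<sim> antipode N (smul (alt_scalar s) (wd s (alt I1 (2 * n))))" for s
  proof -
    let ?m = "(2 * N - 1) * (2 * n)"
    \<comment> \<open>Reversing an alternating word of even length changes its first index; for
      \<open>s\<close> true the transposition of the letters changes it back.\<close>
    have 1: "antipode N (wd s (alt i (2 * n))) \<sim> z s ^ ?m * wd s (alt (swap_if s (other i)) (2 * n))" for i
      using antipode_wd[of s "alt i (2 * n)"] by (cases s) (simp_all add: map_other_alt rev_alt)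
    have "antipode N (wd s (alt I2 (2 * n))) \<sim> z s ^ ?m * wd s (alt (swap_if s (other I2)) (2 * n))"
      by (rule 1)
    also have "\<dots> \<sim> z s ^ ?m * smul (alt_scalar s) (wd s (alt (swap_if s (other I1)) (2 * n)))"
      using wd_alt_eqI[of s] wd_alt_eqI'[of s] by (intro eqI_mult eqm_refl) auto
    also have "\<dots> = smul (alt_scalar s) (z s ^ ?m * wd s (alt (swap_if s (other I1)) (2 * n)))" by simp
    also have "\<dots> \<sim> smul (alt_scalar s) (antipode N (wd s (alt I1 (2 * n))))"
      by (intro eqm_smul eqm_sym[OF 1])
    finally show ?thesis by (simp add: lin_smul[OF lin_antipode])
  qed
  have unit: "antipode N (wd False (replicate (2 * N) I1) + smul \<mu> (wd True (replicate (2 * N) I1))) \<sim> antipode N 1"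
  proof -
    have 1: "antipode N (wd s (replicate (2 * N) I1)) \<sim> wd s (replicate (2 * N) I1)" for s
    proof -
      let ?m = "2 * N * (2 * N - 1)"
      have "antipode N (wd s (replicate (2 * N) I1)) \<sim> z s ^ ?m * wd s (replicate (2 * N) (swap_if s I1))"
        using antipode_wd[of s "replicate (2 * N) I1"] by (simp add: mult.commute)
      \<comment> \<open>The 2N letters contribute an exponent divisible by 2N, which the nonempty
        word absorbs.\<close>
      also have "\<dots> \<sim> wd s (replicate (2 * N) (swap_if s I1))"
        using N_pos by (intro z_power_absorb_mult) simp
      also have "\<dots> \<sim> z s ^ N" by (rule wd_replicate_eqI)
      also have "\<dots> \<sim> wd s (replicate (2 * N) I1)" by (rule eqm_sym[OF wd_replicate_eqI])
      finally show ?thesis .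
    qed
    have "antipode N (wd False (replicate (2 * N) I1)) + smul \<mu> (antipode N (wd True (replicate (2 * N) I1)))
      \<sim> wd False (replicate (2 * N) I1) + smul \<mu> (wd True (replicate (2 * N) I1))"
      by (intro eqm_add eqm_smul 1)
    also note wd_unit_eqI
    finally show ?thesis by (simp add: lin_add[OF lin_antipode] lin_smul[OF lin_antipode] antipode_1)
  qed
  have mix: "antipode N (wd s [i] * wd (\<not> s) [j]) \<sim> 0" for s i j
  proof -
    \<comment> \<open>A positive exponent makes both powers nonempty words, as the mixed-sign
      relation requires.\<close>
    have "4 * N - 1 > 0" using N_pos by simp
    then have "replicate (4 * N - 1) k \<noteq> []" for k :: idx by simp
    then show ?thesis
      unfolding antipode_mult antipode_letter wd_replicate[symmetric] by (intro wd_mixed') auto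
  qed
  have "eqm SI (antipode N (wd True (alt I2 (2 * n)))) (antipode N (smul lam (wd True (alt I1 (2 * n)))))"
    using alt[of True] by (simp add: alt_scalar_def)
  moreover have "eqm SI (antipode N (wd False (alt I1 (2 * n)))) (antipode N (wd False (alt I2 (2 * n))))"
    using eqm_sym[OF alt[of False]] by (simp add: alt_scalar_def)
  ultimately show ?thesis
    using assms unfolding wd_relators
    by (elim UnE insertE CollectE exE conjE emptyE)
      (simp_all only: diff sq unit mix)
qed

lemma antipode_ideal: "x \<in> SI \<Longrightarrow> antipode N x \<in> SI"
proof -
  assume "x \<in> SI"
  then have "antipode N x \<in> fs.span SI"
    unfolding suzuki_ideal_def
  proof (rule lin_span[OF lin_antipode, rotated], safe)
    fix u r v assume "r \<in> suzuki_relators N n \<mu> lam"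
    then have "antipode N v * antipode N r * antipode N u \<sim> antipode N v * 0 * antipode N u"
      by (intro eqI_mult eqm_refl antipode_relator)
    then show "antipode N (u * r * v) \<in> fs.span (fs.span {u * r * v |u r v. r \<in> suzuki_relators N n \<mu> lam})"
      by (simp add: antipode_mult eqm_def suzuki_ideal_def mult.assoc)
  qed
  then show ?thesis by simp
qed

text \<open>Of the two outer letters, one continues the alternation and the other meets an equal
  letter. The resulting square sits at the left end if \<open>i = k\<close> and at the right end
  otherwise.\<close>

lemma letter_alt_letter:
  "wd s [i] * wd s (alt k (2 * t + 1)) * wd s [other i] \<sim> z s * wd s (alt (other k) (2 * t + 1))"
proof (cases "i = k")
  case True
  have "alt k (2 * t + 1) @ [other k] = k # alt (other k) (2 * t + 1)"
    using alt_snoc[of k "2 * t + 1"] by simp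
  then have "wd s [i] * wd s (alt k (2 * t + 1)) * wd s [other i] = wd s [k, k] * wd s (alt (other k) (2 * t + 1))"
    using True by (simp only: mult.assoc append_Cons append_Nil flip: wd_append)
  also have "\<dots> \<sim> z s * wd s (alt (other k) (2 * t + 1))"
    by (intro eqI_mult eqm_refl wd_square_eqI)
  finally show ?thesis .
next
  case False
  then have i: "i = other k" by (cases i; cases k) auto
  have "other k # alt k (2 * t + 1) = alt (other k) (2 * t + 1) @ [k]"
    using alt_snoc[of "other k" "2 * t + 1"] by simp
  then have "wd s [i] * wd s (alt k (2 * t + 1)) * wd s [other i] = wd s (alt (other k) (2 * t + 1)) * wd s [k, k]"
    using i by (simp only: append_Cons append_Nil append_assoc other_other flip: wd_append)
  also have "\<dots> \<sim> wd s (alt (other k) (2 * t + 1)) * z s"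
    by (intro eqI_mult eqm_refl wd_square_eqI)
  also have "\<dots> \<sim> z s * wd s (alt (other k) (2 * t + 1))"
    by (rule eqm_sym[OF z_central])
  finally show ?thesis .
qed

lemma wd_G_word_eqI: "wd s (G_word m t i) \<sim> z s ^ m * wd s (alt i (2 * t + 1))"
  unfolding G_word_def wd_append by (intro eqI_mult eqm_refl wd_replicate_eqI)

lemma wd_map_other_G_word: "wd s (map other (G_word m t i)) \<sim> wd s (G_word m t (other i))"
proof -
  have "wd s (map other (G_word m t i)) = wd s (replicate (2 * m) I2) * wd s (alt (other i) (2 * t + 1))"
    by (simp add: G_word_def map_other_alt flip: wd_append)
  also have "\<dots> \<sim> z s ^ m * wd s (alt (other i) (2 * t + 1))"
    by (intro eqI_mult eqm_refl wd_replicate_eqI)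
  also have "\<dots> \<sim> wd s (G_word m t (other i))" by (rule eqm_sym[OF wd_G_word_eqI])
  finally show ?thesis .
qed

text \<open>This evaluates the factor h_(1) g S(h_(3)) of the Yetter-Drinfeld action. The antipode
  power supplies z^(2N-1), the square from \<open>letter_alt_letter\<close> one more z, and z^(2N)
  is absorbed.\<close>

lemma letter_G_word_letter:
  "wd s [i] * wd s (G_word m t k) * wd s [other i] ^ (4 * N - 1) \<sim> wd s (G_word m t (other k))"
proof -
  let ?A = "\<lambda>i. wd s (alt i (2 * t + 1))"
  have "wd s [i] * wd s (G_word m t k) * wd s [other i] ^ (4 * N - 1)
      \<sim> wd s [i] * (z s ^ m * ?A k) * (z s ^ (2 * N - 1) * wd s [other i])"
    by (intro eqI_mult eqm_refl wd_G_word_eqI wd_letter_power)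
  also have "\<dots> = (wd s [i] * z s ^ m) * (?A k * z s ^ (2 * N - 1)) * wd s [other i]"
    by (simp add: mult.assoc)
  also have "\<dots> \<sim> (z s ^ m * wd s [i]) * (z s ^ (2 * N - 1) * ?A k) * wd s [other i]"
    by (intro eqI_mult eqm_refl z_power_central)
  also have "\<dots> = z s ^ m * (wd s [i] * z s ^ (2 * N - 1)) * (?A k * wd s [other i])"
    by (simp add: mult.assoc)
  also have "\<dots> \<sim> z s ^ m * (z s ^ (2 * N - 1) * wd s [i]) * (?A k * wd s [other i])"
    by (intro eqI_mult eqm_refl z_power_central)
  also have "\<dots> = z s ^ m * z s ^ (2 * N - 1) * (wd s [i] * ?A k * wd s [other i])"
    by (simp add: mult.assoc)
  also have "\<dots> \<sim> z s ^ m * z s ^ (2 * N - 1) * (z s * ?A (other k))"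
    by (intro eqI_mult eqm_refl letter_alt_letter)
  also have "\<dots> = z s ^ m * (z s ^ (2 * N - 1) * z s) * ?A (other k)"
    by (simp add: mult.assoc)
  also have "z s ^ (2 * N - 1) * z s = z s ^ (2 * N)"
    using N_pos by (simp flip: power_Suc2)
  also have "z s ^ m * z s ^ (2 * N) * ?A (other k) = z s ^ m * (z s ^ (2 * N) * ?A (other k))"
    by (simp add: mult.assoc)
  also have "\<dots> \<sim> z s ^ m * ?A (other k)"
    by (intro eqI_mult eqm_refl z_power_absorb) simp
  also have "\<dots> \<sim> wd s (G_word m t (other k))" by (rule eqm_sym[OF wd_G_word_eqI])
  finally show ?thesis .
qed

end

section \<open>The action, coaction and braiding on \<open>V \<boxtimes> A\<close>\<close>

text \<open>Turns definitions given on basis pairs into formulas for arbitrary pure tensors.\<close>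

lemma lin_ext_bilinear:
  assumes "\<And>q. lin (\<lambda>p. F p q)" "\<And>p. lin (F p)"
  shows "lin_ext (\<lambda>(b, c). F (bas b) (bas c)) (tens p q) = F p q"
  unfolding lin_ext_tens
proof (rule lin_eqI[where p = p])
  fix b show "lin_ext (\<lambda>b. lin_ext (\<lambda>c. case (b, c) of (b, c) \<Rightarrow> F (bas b) (bas c)) q) (bas b) = F (bas b) q"
    unfolding lin_ext_bas by (rule lin_eqI[where p = q]) (intro lin_intros, rule assms, simp)
qed (intro lin_intros, rule assms)

lemma lin_word_act: "lin (word_act act w)"
proof (induction w)
  case Nil
  have "word_act act [] = (\<lambda>m. m)" by auto
  then show ?case by (simp only: lin_id)
next
  case (Cons g w)
  have "word_act act (g # w) = (\<lambda>m. lin_ext (act g) (word_act act w m))" by auto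
  then show ?case by (simp only: lin_lin_ext'[OF Cons])
qed

lemma lin_word_act' [lin_intros]: "lin f \<Longrightarrow> lin (\<lambda>x. word_act act w (f x))"
  by (rule lin_comp[OF lin_word_act])

lemma word_act_append: "word_act act (u @ v) m = word_act act u (word_act act v m)"
  by (induction u) auto

definition vact :: "('v, 'k::field) gen_act \<Rightarrow> 'k free_alg \<Rightarrow> ('v \<Rightarrow>\<^sub>0 'k) \<Rightarrow> ('v \<Rightarrow>\<^sub>0 'k)" where
  "vact act h v = lin_ext (\<lambda>w. word_act act w v) h"

lemma lin_vact_left [lin_intros]: "lin f \<Longrightarrow> lin (\<lambda>x. vact act (f x) v)"
  unfolding vact_def by (rule lin_lin_ext')

lemma lin_vact_right [lin_intros]: "lin f \<Longrightarrow> lin (\<lambda>x. vact act h (f x))"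
  unfolding vact_def by (intro lin_intros)

lemma vact_bas [simp]: "vact act (bas w) v = word_act act w v"
  by (simp add: vact_def)

lemma vact_mult: "vact act (p * q) v = vact act p (vact act q v)"
proof (rule lin_eqI[where p = p])
  fix u show "vact act (bas u * q) v = vact act (bas u) (vact act q v)"
    by (rule lin_eqI[where p = q])
      ((intro lin_intros)+, simp add: word_act_append flip: bas_append)
qed (intro lin_intros)+

lemma vact_1 [simp]: "vact act 1 v = v"
  using vact_bas[of act "[]" v] by (simp add: bas_Nil)

text \<open>The Yetter-Drinfeld action with the iterated coproduct of h replaced by an arbitrary
  triple tensor, so that relations can be treated in each of the three factors separately.\<close>

definition yd_triple :: "('v, 'k::field) gen_act \<Rightarrow> nat \<Rightarrow> ('v \<Rightarrow>\<^sub>0 'k) \<Rightarrow> 'k free_alg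
    \<Rightarrow> ((word \<times> word) \<times> word \<Rightarrow>\<^sub>0 'k) \<Rightarrow> ('v \<times> word \<Rightarrow>\<^sub>0 'k)" where
  "yd_triple act N v g =
     lin_ext (\<lambda>((h1, h2), h3). tens (word_act act h2 v) (bas h1 * g * antipode N (bas h3)))"

lemma lin_yd_triple [lin_intros]: "lin f \<Longrightarrow> lin (\<lambda>x. yd_triple act N v g (f x))"
  unfolding yd_triple_def by (rule lin_lin_ext')

lemma lin_yd_triple1: "lin (\<lambda>v. yd_triple act N v g h)"
  and lin_yd_triple2: "lin (\<lambda>g. yd_triple act N v g h)"
  unfolding yd_triple_def
  by (rule lin_lin_ext_param, clarsimp, intro lin_intros)+

lemma lin_antipode' [lin_intros]: "lin f \<Longrightarrow> lin (\<lambda>x. antipode N (f x))"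
  by (rule lin_comp[OF lin_antipode])

lemma lin_comult' [lin_intros]: "lin f \<Longrightarrow> lin (\<lambda>x. \<Delta> (f x))"
  by (rule lin_comp[OF lin_comult])

lemma yd_triple_tens:
  "yd_triple act N v g (tens (tens a b) c) = tens (vact act b v) (a * g * antipode N c)"
proof (rule lin_eqI[where p = a])
  fix a' show "yd_triple act N v g (tens (tens (bas a') b) c) = tens (vact act b v) (bas a' * g * antipode N c)"
  proof (rule lin_eqI[where p = b])
    fix b' show "yd_triple act N v g (tens (tens (bas a') (bas b')) c)
        = tens (vact act (bas b') v) (bas a' * g * antipode N c)"
      by (rule lin_eqI[where p = c]) ((intro lin_intros)+, simp add: yd_triple_def)
  qed (intro lin_intros)+
qed (intro lin_intros)+

lemma yd_act_tens: "yd_act act N h (tens v g) = yd_triple act N v g (\<Delta>2 h)"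
proof -
  have "yd_act act N h (tens v g) =
      lin_ext (\<lambda>(l, g). yd_triple act N (bas l) (bas g) (\<Delta>2 h)) (tens v g)"
    by (simp add: yd_act_def yd_triple_def)
  also have "\<dots> = yd_triple act N v g (\<Delta>2 h)"
    by (rule lin_ext_bilinear) (rule lin_yd_triple1 lin_yd_triple2)+
  finally show ?thesis .
qed

lemma lin_comult2 [lin_intros]: "lin f \<Longrightarrow> lin (\<lambda>x. \<Delta>2 (f x))"
  unfolding \<Delta>2_def by (intro lin_intros)

lemma lin_yd_act [lin_intros]: "lin f \<Longrightarrow> lin (\<lambda>x. yd_act act N h (f x))"
  unfolding yd_act_def by (rule lin_lin_ext')

lemma lin_yd_act_left [lin_intros]: "lin f \<Longrightarrow> lin (\<lambda>x. yd_act act N (f x) y)"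
  unfolding yd_act_def by (rule lin_lin_ext_param, clarsimp, intro lin_intros)

lemma comult2_mult: "\<Delta>2 (p * q) = \<Delta>2 p * \<Delta>2 q"
proof -
  have "map_tens \<Delta> (\<lambda>g. g) (P * Q) = map_tens \<Delta> (\<lambda>g. g) P * map_tens \<Delta> (\<lambda>g. g) Q"
    for P Q :: "word \<times> word \<Rightarrow>\<^sub>0 'a"
  proof (rule lin_mult_eqI)
    show "lin (map_tens \<Delta> (\<lambda>g. g :: word \<Rightarrow>\<^sub>0 'a))" by (intro lin_intros)
    show "map_tens \<Delta> (\<lambda>g. g) (bas (u + v)) =
        map_tens \<Delta> (\<lambda>g. g) (bas u) * map_tens \<Delta> (\<lambda>g. g :: word \<Rightarrow>\<^sub>0 'a) (bas v)" for u v :: "word \<times> word"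
      by (cases u; cases v)
        (simp add: map_tens_def tens_mult_tens flip: comult_mult bas_mult_bas)
  qed
  then show ?thesis by (simp add: \<Delta>2_def comult_mult)
qed

text \<open>Holds already over the free algebra: the iterated coproduct is multiplicative, and the
  antipode reverses products, so the factors of \<open>p\<close> end up outside those of
  \<open>q\<close>.\<close>

lemma yd_act_mult: "yd_act act N (p * q) y = yd_act act N p (yd_act act N q y)"
proof -
  have *: "yd_triple act N v g (P * Q)
      = lin_ext (\<lambda>(l, g). yd_triple act N (bas l) (bas g) P) (yd_triple act N v g Q)" for v g P Q
  proof (rule lin_eqI[where p = P])
    fix u :: "(word \<times> word) \<times> word"
    show "yd_triple act N v g (bas u * Q)
      = lin_ext (\<lambda>(l, g). yd_triple act N (bas l) (bas g) (bas u)) (yd_triple act N v g Q)"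
    proof (rule lin_eqI[where p = Q])
      fix w :: "(word \<times> word) \<times> word"
      obtain a b c a' b' c' where uw: "u = ((a, b), c)" "w = ((a', b'), c')"
        by (metis surj_pair)
      have u: "bas u = tens (tens (bas a) (bas b)) (bas c)"
        and w: "bas w = tens (tens (bas a') (bas b')) (bas c')"
        and m: "bas u * bas w = tens (tens (bas (a @ a')) (bas (b @ b'))) (bas (c @ c'))"
        by (simp_all add: uw bas_mult_bas plus_list_def)
      have "lin_ext (\<lambda>(l, g). yd_triple act N (bas l) (bas g) (bas u)) (yd_triple act N v g (bas w))
        = yd_triple act N (word_act act b' v) (bas a' * g * antipode N (bas c')) (bas u)"
        unfolding w yd_triple_tens vact_bas
        by (rule lin_ext_bilinear) (rule lin_yd_triple1 lin_yd_triple2)+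
      also have "\<dots> = yd_triple act N v g (bas u * bas w)"
        unfolding m unfolding u
        by (simp only: yd_triple_tens vact_bas vact_mult bas_append antipode_mult mult.assoc)
      finally show "yd_triple act N v g (bas u * bas w)
        = lin_ext (\<lambda>(l, g). yd_triple act N (bas l) (bas g) (bas u)) (yd_triple act N v g (bas w))" ..
    qed (intro lin_intros)+
  qed (intro lin_intros)+
  show ?thesis
  proof (rule lin_eqI[where p = y])
    fix b :: "'a \<times> word"
    obtain l g where b: "b = (l, g)" by (cases b)
    show "yd_act act N (p * q) (bas b) = yd_act act N p (yd_act act N q (bas b))"
      using *[of "bas l" "bas g" "\<Delta>2 p" "\<Delta>2 q"]
      unfolding b tens_bas[symmetric] yd_act_tens comult2_mult
      by (simp add: yd_act_def yd_triple_def)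
  qed (intro lin_intros)+
qed

lemma yd_act_1: "yd_act act N 1 y = y"
proof (rule lin_eqI[where p = y])
  fix b :: "'a \<times> word"
  obtain l g where b: "b = (l, g)" by (cases b)
  have 1: "(1 :: word \<times> word \<Rightarrow>\<^sub>0 'b) = tens 1 1"
    by (simp add: zero_prod_def flip: single_one)
  have "\<Delta>2 (1 :: 'b free_alg) = tens (tens 1 1) 1"
    by (simp add: \<Delta>2_def comult_1 1) (simp add: map_tens_tens lin_comult lin_id comult_1 1)
  then show "yd_act act N 1 (bas b) = bas b"
    unfolding b tens_bas[symmetric] yd_act_tens by (simp add: yd_triple_tens antipode_1 flip: tens_bas)
qed (intro lin_intros)+

text \<open>The four terms come from the iterated coproduct, the sum of x_ik \<otimes> x_kl
  \<otimes> x_lj over k and l.\<close>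

lemma yd_act_X:
  fixes act :: "('v, 'k::field) gen_act"
  shows "yd_act act N (X i j) (tens v g) =
     (tens (vact act (X I1 I1) v) (X i I1 * g * X j I1 ^ (4 * N - 1))
       + tens (vact act (X I2 I1) v) (X i I2 * g * X j I1 ^ (4 * N - 1)))
     + (tens (vact act (X I1 I2) v) (X i I1 * g * X j I2 ^ (4 * N - 1))
       + tens (vact act (X I2 I2) v) (X i I2 * g * X j I2 ^ (4 * N - 1)))"
proof -
  have "\<Delta>2 (X i j :: 'k free_alg) =
     (tens (tens (X i I1) (X I1 I1)) (X I1 j) + tens (tens (X i I2) (X I2 I1)) (X I1 j))
     + (tens (tens (X i I1) (X I1 I2)) (X I2 j) + tens (tens (X i I2) (X I2 I2)) (X I2 j))"
    unfolding \<Delta>2_def comult_X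
    by (simp add: lin_add[OF lin_map_tens[OF lin_id]] map_tens_tens lin_comult lin_id comult_X tens_simps)
  then show ?thesis
    by (simp add: yd_act_tens lin_add[OF lin_yd_triple[OF lin_id]] yd_triple_tens antipode_X)
qed

text \<open>The coaction with the coproduct of g as a free argument, through which congruences can
  be pushed; \<open>braid_map\<close> plays the same part for the braiding.\<close>

definition coact_map :: "('v \<Rightarrow>\<^sub>0 'k::field) \<Rightarrow> (word \<times> word \<Rightarrow>\<^sub>0 'k) \<Rightarrow> (word \<times> ('v \<times> word) \<Rightarrow>\<^sub>0 'k)" where
  "coact_map v = lin_ext (\<lambda>(g1, g2). tens (bas g1) (tens v (bas g2)))"

lemma lin_coact_map [lin_intros]: "lin f \<Longrightarrow> lin (\<lambda>x. coact_map v (f x))"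
  unfolding coact_map_def by (rule lin_lin_ext')

lemma lin_coact_map1 [lin_intros]: "lin f \<Longrightarrow> lin (\<lambda>v. coact_map (f v) d)"
  unfolding coact_map_def by (intro lin_intros)

lemma coact_map_tens: "coact_map v (tens a b) = tens a (tens v b)"
  unfolding coact_map_def by (rule lin_ext_bilinear) (intro lin_intros)+

lemma lin_yd_coact [lin_intros]: "lin f \<Longrightarrow> lin (\<lambda>x. yd_coact (f x))"
  unfolding yd_coact_def by (rule lin_lin_ext')

lemma yd_coact_tens: "yd_coact (tens v g) = coact_map v (\<Delta> g)"
proof -
  have "yd_coact (tens v g) = lin_ext (\<lambda>(l, g). coact_map (bas l) (\<Delta> (bas g))) (tens v g)"
    by (simp add: yd_coact_def coact_map_def)
  also have "\<dots> = coact_map v (\<Delta> g)"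
    by (rule lin_ext_bilinear) (intro lin_intros)+
  finally show ?thesis .
qed

definition braid_map :: "('v, 'k::field) gen_act \<Rightarrow> nat \<Rightarrow> ('v \<times> word \<Rightarrow>\<^sub>0 'k)
    \<Rightarrow> (word \<times> ('v \<times> word) \<Rightarrow>\<^sub>0 'k) \<Rightarrow> (('v \<times> word) \<times> ('v \<times> word) \<Rightarrow>\<^sub>0 'k)" where
  "braid_map act N y = lin_ext (\<lambda>(h, x0). tens (yd_act act N (bas h) y) (bas x0))"

lemma lin_braid_map [lin_intros]: "lin f \<Longrightarrow> lin (\<lambda>x. braid_map act N y (f x))"
  unfolding braid_map_def by (rule lin_lin_ext')

lemma lin_braid_map1 [lin_intros]: "lin f \<Longrightarrow> lin (\<lambda>y. braid_map act N (f y) d)"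
  unfolding braid_map_def by (intro lin_intros)

lemma braid_map_tens: "braid_map act N y (tens h x) = tens (yd_act act N h y) x"
  unfolding braid_map_def by (rule lin_ext_bilinear) (intro lin_intros)+

lemma lin_yd_braid [lin_intros]: "lin f \<Longrightarrow> lin (\<lambda>x. yd_braid act N (f x))"
  unfolding yd_braid_def by (rule lin_lin_ext')

lemma yd_braid_tens: "yd_braid act N (tens x y) = braid_map act N y (yd_coact x)"
proof -
  have "yd_braid act N (tens x y) = lin_ext (\<lambda>(x, y). braid_map act N (bas y) (yd_coact (bas x))) (tens x y)"
    by (simp add: yd_braid_def braid_map_def)
  also have "\<dots> = braid_map act N y (yd_coact x)"
    by (rule lin_ext_bilinear) (intro lin_intros)+
  finally show ?thesis .
qed

section \<open>Descent of action, coaction and braiding to the quotient\<close>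

locale suzuki_module = suzuki N n \<mu> lam for N n and \<mu> lam :: "'k::field" +
  fixes act :: "('v, 'k) gen_act"
  assumes vact_ideal: "x \<in> suzuki_ideal N n \<mu> lam \<Longrightarrow> vact act x v = 0"
begin

abbreviation R :: "('v \<times> word \<Rightarrow>\<^sub>0 'k) set" where "R \<equiv> yd_rel N n \<mu> lam"

lemma span_R [simp]: "fs.span R = R"
  by (simp add: yd_rel_def)

lemma tens_ideal_R: "s \<in> SI \<Longrightarrow> tens p s \<in> R"
  unfolding yd_rel_def by (rule rel_tens_right) simp

lemma lin_R:
  assumes "x \<in> R" "lin f" "\<And>p s. s \<in> SI \<Longrightarrow> f (tens p s) \<in> fs.span T"
  shows "f x \<in> fs.span T"
  using assms(1) unfolding yd_rel_def
  by (rule lin_rel_tens) (auto simp: assms tens_simps lin_0[OF assms(2)] fs.span_zero)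

lemma ideal_SI_mult: "s \<in> SI \<Longrightarrow> u * s \<in> SI" "s \<in> SI \<Longrightarrow> s * u \<in> SI"
  using ideal_SI by (auto simp: ideal_def)

lemma yd_act_R: "y \<in> R \<Longrightarrow> yd_act act N h y \<in> R"
proof -
  assume y: "y \<in> R"
  have "yd_act act N h y \<in> fs.span R"
  proof (rule lin_R[OF y])
    fix p s assume s: "s \<in> SI"
    have 1: "yd_triple act N p s (tens (bas ab) (bas c)) \<in> fs.span R" for ab c
      by (cases ab) (simp add: yd_triple_def tens_ideal_R ideal_SI_mult s)
    have "yd_triple act N p s (\<Delta>2 h) \<in> fs.span R"
      by (rule bas_pair_span) (intro lin_intros, rule 1)
    then show "yd_act act N h (tens p s) \<in> fs.span R" by (simp add: yd_act_tens)
  qed (intro lin_intros)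
  then show ?thesis by simp
qed

text \<open>The iterated coproduct of a relation has a relation in one of its three factors. In the
  first or third factor it puts the algebra component into the ideal, through the antipode in the
  latter case; in the middle factor it annihilates \<open>V\<close>.\<close>

lemma yd_act_ideal:
  assumes h: "h \<in> SI"
  shows "yd_act act N h y \<in> R"
proof -
  have *: "yd_triple act N v g (\<Delta>2 h) \<in> fs.span R" for v g
    unfolding \<Delta>2_def
  proof (rule lin_rel_tens[OF comult_ideal[OF h]])
    show "lin (\<lambda>x. yd_triple act N v g (map_tens \<Delta> (\<lambda>g. g) x))" by (intro lin_intros)
  next
    fix r q assume "r \<in> SI"
    have "yd_triple act N v g (tens (\<Delta> r) q) \<in> fs.span R"
    proof (rule lin_rel_tens[OF comult_ideal[OF \<open>r \<in> SI\<close>]])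
      show "lin (\<lambda>x. yd_triple act N v g (tens x q))" by (intro lin_intros)
    qed (simp_all add: yd_triple_tens tens_ideal_R ideal_SI_mult vact_ideal tens_simps fs.span_zero[of R, simplified])
    then show "yd_triple act N v g (map_tens \<Delta> (\<lambda>g. g) (tens r q)) \<in> fs.span R"
      by (simp only: map_tens_tens[OF lin_comult lin_id])
  next
    fix p s assume s: "s \<in> SI"
    have "yd_triple act N v g (tens (\<Delta> p) s) \<in> fs.span R"
    proof (rule bas_pair_span[where f = "\<lambda>x. yd_triple act N v g (tens x s)"])
      show "lin (\<lambda>x. yd_triple act N v g (tens x s))" by (intro lin_intros)
    qed (simp only: yd_triple_tens span_R tens_ideal_R ideal_SI_mult antipode_ideal s)
    then show "yd_triple act N v g (map_tens \<Delta> (\<lambda>g. g) (tens p s)) \<in> fs.span R"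
      by (simp only: map_tens_tens[OF lin_comult lin_id])
  qed
  have "yd_act act N h y \<in> fs.span R"
    by (rule bas_pair_span[where x = y]) (intro lin_intros, simp only: yd_act_tens *)
  then show ?thesis by simp
qed

lemma coact_map_eqm: "eqm SI2 d d' \<Longrightarrow> eqm (rel_tens SI R) (coact_map v d) (coact_map v d')"
proof -
  assume "eqm SI2 d d'"
  then have d: "d - d' \<in> SI2" by (simp add: eqm_def)
  have "coact_map v (d - d') \<in> fs.span (rel_tens SI R)"
    by (rule lin_rel_tens[OF d], intro lin_intros)
      (simp_all add: coact_map_tens rel_tens_left rel_tens_right tens_ideal_R)
  then show ?thesis by (simp add: eqm_def lin_diff[OF lin_coact_map[OF lin_id]])
qed

lemma yd_coact_R: "x \<in> R \<Longrightarrow> yd_coact x \<in> rel_tens SI R"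
proof -
  assume x: "x \<in> R"
  have "yd_coact x \<in> fs.span (rel_tens SI R)"
  proof (rule lin_R[OF x])
    fix p s assume "s \<in> SI"
    then have "eqm SI2 (\<Delta> s) 0" by (simp add: eqm_def comult_ideal)
    from coact_map_eqm[OF this, of p] show "yd_coact (tens p s) \<in> fs.span (rel_tens SI R)"
      by (simp add: yd_coact_tens eqm_def lin_0[OF lin_coact_map[OF lin_id]])
  qed (intro lin_intros)
  then show ?thesis by simp
qed

lemma braid_map_eqm: "eqm (rel_tens SI R) d d' \<Longrightarrow> eqm (rel_tens R R) (braid_map act N y d) (braid_map act N y d')"
proof -
  assume "eqm (rel_tens SI R) d d'"
  then have d: "d - d' \<in> rel_tens SI R" by (simp add: eqm_def)
  have "braid_map act N y (d - d') \<in> fs.span (rel_tens R R)"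
    by (rule lin_rel_tens[OF d], intro lin_intros)
      (simp_all add: braid_map_tens rel_tens_left rel_tens_right yd_act_ideal)
  then show ?thesis by (simp add: eqm_def lin_diff[OF lin_braid_map[OF lin_id]])
qed

text \<open>A relation on the left passes through the coaction and then acts as zero or stays in the
  right factor; a relation on the right is preserved by the action.\<close>

lemma yd_braid_R: "yd_braid act N ` rel_tens R R \<subseteq> rel_tens R R"
proof -
  have "yd_braid act N x \<in> fs.span (rel_tens R R)" if x: "x \<in> rel_tens R R" for x
  proof (rule lin_rel_tens[OF x])
    fix r q assume "r \<in> R"
    then have "eqm (rel_tens SI R) (yd_coact r) 0" by (simp add: eqm_def yd_coact_R)
    from braid_map_eqm[OF this, of q] show "yd_braid act N (tens r q) \<in> fs.span (rel_tens R R)"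
      by (simp add: yd_braid_tens eqm_def lin_0[OF lin_braid_map[OF lin_id]])
  next
    fix p s assume s: "s \<in> R"
    show "yd_braid act N (tens p s) \<in> fs.span (rel_tens R R)"
      unfolding yd_braid_tens
      by (rule bas_pair_span[where x = "yd_coact p"], intro lin_intros)
        (simp only: braid_map_tens span_rel_tens rel_tens_left yd_act_R s span_R)
  qed (intro lin_intros)
  then show ?thesis by auto
qed

end

section \<open>The action on the two lines\<close>

text \<open>
  The scalars in \<open>x\<^sub>1\<^sub>2 u\<^sub>l = coef I1 l u\<^sub>m\<close> and \<open>x\<^sub>2\<^sub>1 u\<^sub>l = coef I2 l u\<^sub>m\<close>, \<open>m \<noteq> l\<close>, for \<open>u = v'\<close> and for
  \<open>u = w\<close>.  In the application \<open>M = mu_bar * \<omega> ^ (8kn)\<close> and \<open>\<theta> = \<omega> ^ (2jN)\<close>.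
\<close>
fun coef :: "'k::field \<Rightarrow> 'k \<Rightarrow> idx \<Rightarrow> idx \<Rightarrow> 'k" where
  "coef M \<theta> I1 I1 = 1"
| "coef M \<theta> I1 I2 = M"
| "coef M \<theta> I2 I1 = \<theta>"
| "coef M \<theta> I2 I2 = M / \<theta>"

abbreviation flip_if_odd :: "nat \<Rightarrow> idx \<Rightarrow> idx" where
  "flip_if_odd m l \<equiv> if even m then l else other l"

text \<open>The scalar by which a whole word acts. Letters act from the right, so a letter meets the
  line reached after all letters behind it.\<close>

fun word_coef :: "'k::field \<Rightarrow> 'k \<Rightarrow> idx list \<Rightarrow> idx \<Rightarrow> 'k" where
  "word_coef M \<theta> [] l = 1"
| "word_coef M \<theta> (i # ws) l = coef M \<theta> i (flip_if_odd (length ws) l) * word_coef M \<theta> ws l"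

lemma coef_square: "\<theta> \<noteq> 0 \<Longrightarrow> coef M \<theta> i (other l) * coef M \<theta> i l = M"
  by (cases i; cases l) auto

lemma word_coef_append:
  "word_coef M \<theta> (u @ v) l = word_coef M \<theta> u (flip_if_odd (length v) l) * word_coef M \<theta> v l"
  by (induction u) (auto simp: mult.assoc)

lemma word_coef_replicate:
  "\<theta> \<noteq> 0 \<Longrightarrow> word_coef M \<theta> (replicate (2 * m) i) l = M ^ m"
  by (induction m) (simp_all add: mult.assoc[symmetric] coef_square)

lemma word_coef_alt_even:
  "word_coef M \<theta> (alt i (2 * m)) l = (coef M \<theta> i (other l) * coef M \<theta> (other i) l) ^ m"
  by (induction m) (simp_all add: mult.assoc)

lemma word_coef_alt_odd:
  "word_coef M \<theta> (alt i (2 * m + 1)) l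
    = coef M \<theta> i l * (coef M \<theta> (other i) (other l) * coef M \<theta> i l) ^ m"
  using word_coef_alt_even[of M \<theta> "other i" m l] by simp

text \<open>Serves both cases: \<open>S = {}\<close> and basis vectors for the module V', and the
  Yetter-Drinfeld relations with \<open>G_vec\<close> for the lines through w_1 and w_2.\<close>

lemma foldr_word_coef:
  assumes "\<And>i. lin (f i)" "\<And>i x. x \<in> S \<Longrightarrow> f i x \<in> fs.span S"
    "\<And>i l. eqm S (f i (u l)) (smul (coef M \<theta> i l) (u (other l)))"
  shows "eqm S (foldr f ws (u l)) (smul (word_coef M \<theta> ws l) (u (flip_if_odd (length ws) l)))"
proof (induction ws)
  case (Cons i ws)
  let ?l = "flip_if_odd (length ws) l"
  have "eqm S (f i (foldr f ws (u l))) (f i (smul (word_coef M \<theta> ws l) (u ?l)))"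
    by (rule eqm_lin[OF Cons assms(1,2)])
  also have "f i (smul (word_coef M \<theta> ws l) (u ?l)) = smul (word_coef M \<theta> ws l) (f i (u ?l))"
    by (simp only: lin_smul[OF assms(1)])
  also have "eqm S \<dots> (smul (word_coef M \<theta> ws l) (smul (coef M \<theta> i ?l) (u (other ?l))))"
    by (intro eqm_smul assms)
  also have "\<dots> = smul (word_coef M \<theta> (i # ws) l) (u (flip_if_odd (length (i # ws)) l))"
    by (simp add: mult.commute)
  finally show ?case by simp
qed simp

lemma vact_wd: "vact act (wd s ws) v = foldr (\<lambda>i. vact act (wd s [i])) ws v"
proof (induction ws)
  case (Cons i ws)
  then show ?case by (simp only: wd_Cons[of s i ws] vact_mult foldr.simps o_apply)
qed simp

lemma yd_act_wd: "yd_act act N (wd s ws) y = foldr (\<lambda>i. yd_act act N (wd s [i])) ws y"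
proof (induction ws)
  case (Cons i ws)
  then show ?case by (simp only: wd_Cons[of s i ws] yd_act_mult foldr.simps o_apply)
qed (simp add: yd_act_1)

section \<open>The two-dimensional module over the Suzuki algebra\<close>

locale suzuki_flip = suzuki N n \<mu> lam for N n and \<mu> lam :: "'k::field" +
  fixes M \<theta> :: 'k and act :: "(idx, 'k) gen_act"
  assumes theta_nz: "\<theta> \<noteq> 0" and M_nz: "M \<noteq> 0"
    and lam_theta: "lam * \<theta> ^ (2 * n) = 1" and mu_M: "\<mu> * M ^ N = 1"
    and act_diag: "act (i, i) l = 0"
    and act_off: "act (i, other i) l = smul (coef M \<theta> i l) (bas (other l))"
begin

lemma vact_letter_False: "vact act (wd False [i]) v = 0"
proof -
  have "lin_ext (act (i, i)) v = 0"
    by (rule lin_eqI[where p = v], intro lin_intros, intro lin_intros) (simp add: act_diag)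
  then show ?thesis by (simp add: wd_def ltr_def)
qed

lemma vact_wd_False: "ws \<noteq> [] \<Longrightarrow> vact act (wd False ws) v = 0"
proof (cases ws)
  case (Cons i ws')
  then show ?thesis by (simp only: wd_Cons[of _ i ws'] vact_mult vact_letter_False)
qed simp

lemma vact_letter_True: "vact act (wd True [i]) (bas l) = smul (coef M \<theta> i l) (bas (other l))"
  by (simp add: wd_def ltr_def act_off)

lemma vact_wd_True:
  "vact act (wd True ws) (bas l) = smul (word_coef M \<theta> ws l) (bas (flip_if_odd (length ws) l))"
proof -
  have "eqm {} (foldr (\<lambda>i. vact act (wd True [i])) ws (bas l))
      (smul (word_coef M \<theta> ws l) (bas (flip_if_odd (length ws) l)))"
    by (rule foldr_word_coef) (intro lin_intros, simp_all add: vact_letter_True)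
  then show ?thesis by (subst vact_wd) (simp add: eqm_def)
qed

text \<open>Diagonal words act by 0 and both off-diagonal squares by \<open>M\<close>. The unit
  relation then becomes \<open>mu_M\<close>, and the off-diagonal alternating relation becomes
  \<open>lam_theta\<close>.\<close>

lemma vact_relator:
  assumes "r \<in> suzuki_relators N n \<mu> lam"
  shows "vact act r v = 0"
proof (rule lin_eqI[where p = v])
  fix l
  have N': "replicate (2 * N) I1 \<noteq> []" using N_pos by simp
  have sq: "vact act (wd s [i, i]) (bas l) = (if s then smul M (bas l) else 0)" for s i
    using coef_square[OF theta_nz, of M i l] by (cases s) (simp_all add: vact_wd_False vact_wd_True)
  have nz: "\<theta> ^ n \<noteq> 0" using theta_nz by simp
  have th: "lam * \<theta> ^ n * \<theta> ^ n = 1"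
    using lam_theta by (simp add: mult_2 power_add mult.assoc)
  then have th': "lam * inverse (\<theta> ^ n) = \<theta> ^ n"
    using nz lam_square by (simp add: field_simps) (metis mult.assoc mult.commute mult_1_left)
  have th'': "inverse (\<theta> ^ n) = lam * \<theta> ^ n"
    using th by (simp add: inverse_unique mult.commute)
  \<comment> \<open>One alternating product acts by (M \<theta>)^n and the other by (M /
    \<theta>)^n, in an order depending on \<open>l\<close>. Their ratio is \<theta>^(2n) or its
    inverse, and both equal \<open>lam\<close> as \<open>lam\<close> squares to 1.\<close>
  have alt: "word_coef M \<theta> (alt I2 (2 * n)) l = lam * word_coef M \<theta> (alt I1 (2 * n)) l"
    using th' th'' by (cases l) (simp_all add: word_coef_alt_even power_mult_distrib divide_inverse power_inverse lam_square)
  have 0: "vact act (x - y) b = vact act x b - vact act y b"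
    "vact act (x + y) b = vact act x b + vact act y b"
    "vact act (smul k x) b = smul k (vact act x b)" for x y k b
    by (simp_all only: lin_diff[OF lin_vact_left[OF lin_id]] lin_add[OF lin_vact_left[OF lin_id]]
      lin_smul[OF lin_vact_left[OF lin_id]])
  have mix: "vact act (wd s [i] * wd (\<not> s) [j]) v = 0" for s i j v
    using lin_0[OF lin_vact_right[OF lin_id]]
    by (cases s) (simp_all add: vact_mult vact_letter_False)
  have 1: "vact act (wd False (alt i (2 * n))) (bas l) = 0" for i
    by (intro vact_wd_False alt_n_neq_Nil)
  have 2: "vact act (wd True (alt I2 (2 * n))) (bas l) = vact act (smul lam (wd True (alt I1 (2 * n)))) (bas l)"
    by (simp add: 0 vact_wd_True alt)
  have 3: "vact act (wd False (replicate (2 * N) I1) + smul \<mu> (wd True (replicate (2 * N) I1))) (bas l)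
      = vact act 1 (bas l)"
    unfolding 0 vact_wd_False[OF N'] vact_wd_True word_coef_replicate[OF theta_nz]
    by (simp add: mu_M)
  from assms show "vact act r (bas l) = 0"
    unfolding wd_relators
    by (elim UnE insertE CollectE exE conjE emptyE) (simp_all only: 0(1) sq mix 1 2 3 diff_self)
qed (rule lin_vact_right[OF lin_id] lin_zero_map)+

sublocale suzuki_module N n \<mu> lam act
proof
  fix x v assume x: "x \<in> SI"
  \<comment> \<open>Membership in the span of the empty set expresses vanishing, so the span lemma
    applies.\<close>
  have "vact act x v \<in> fs.span {}"
    using x unfolding suzuki_ideal_def
  proof (rule lin_span[where f = "\<lambda>x. vact act x v", rotated 2])
    show "lin (\<lambda>x. vact act x v)" by (intro lin_intros)
  next
    fix x assume "x \<in> {u * r * v |u r v. r \<in> suzuki_relators N n \<mu> lam}"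
    then obtain a r b where "x = a * r * b" "r \<in> suzuki_relators N n \<mu> lam" by blast
    then show "vact act x v \<in> fs.span {}"
      by (simp add: vact_mult vact_relator lin_0[OF lin_vact_right[OF lin_id]])
  qed
  then show "vact act x v = 0" by simp
qed

lemma eqm_tens_R: "g \<sim> g' \<Longrightarrow> eqm R (tens v g) (tens v g')"
  unfolding yd_rel_def by (intro eqm_tens eqm_refl)

lemma vact_X_diag: "vact act (X i i) v = 0"
  using vact_letter_False[of i] by (simp add: wd_conv_X)

lemma yd_act_letter:
  "yd_act act N (X i j) (tens v g) =
     tens (vact act (wd True [I2]) v) (X i I2 * g * X j I1 ^ (4 * N - 1))
     + tens (vact act (wd True [I1]) v) (X i I1 * g * X j I2 ^ (4 * N - 1))"
  by (simp add: yd_act_X vact_X_diag tens_simps wd_conv_X)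

lemma mixed_left: "s \<noteq> s' \<Longrightarrow> ws \<noteq> [] \<Longrightarrow> wd s [i] * wd s' ws * y \<sim> 0"
  using eqI_mult[OF wd_mixed'[of s s' "[i]" ws] eqm_refl[of SI y]] by simp

lemma mixed_right: "s \<noteq> s' \<Longrightarrow> ws \<noteq> [] \<Longrightarrow> y * wd s ws * wd s' [i] ^ (4 * N - 1) \<sim> 0"
proof -
  assume *: "s \<noteq> s'" "ws \<noteq> []"
  have "replicate (4 * N - 1) i \<noteq> []" using N_pos by simp
  then have "wd s ws * wd s' [i] ^ (4 * N - 1) \<sim> 0"
    unfolding wd_replicate[symmetric] using * by (intro wd_mixed') auto
  from eqI_mult[OF eqm_refl[of SI y] this] show ?thesis by (simp add: mult.assoc)
qed

text \<open>For a diagonal letter the two outer factors have opposite signs in each surviving term,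
  so one of them clashes with the word between them.\<close>

lemma yd_act_letter_False:
  assumes "ws \<noteq> []"
  shows "eqm R (yd_act act N (wd False [i]) (tens v (wd s ws))) 0"
proof -
  have 1: "X i I2 * wd s ws * X i I1 ^ (4 * N - 1) \<sim> 0"
    using assms unfolding X_conv_wd
    by (cases i; cases s) (simp_all add: mixed_left mixed_right del: One_nat_def)
  have 2: "X i I1 * wd s ws * X i I2 ^ (4 * N - 1) \<sim> 0"
    using assms unfolding X_conv_wd
    by (cases i; cases s) (simp_all add: mixed_left mixed_right del: One_nat_def)
  have "eqm R (yd_act act N (X i i) (tens v (wd s ws)))
    (tens (vact act (wd True [I2]) v) 0 + tens (vact act (wd True [I1]) v) 0)"
    unfolding yd_act_letter by (intro eqm_add eqm_tens_R 1 2)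
  then show ?thesis by (simp add: wd_conv_X tens_simps)
qed

text \<open>For an off-diagonal letter the outer factors of each surviving term have equal signs.
  Exactly one term matches the sign of the word, which also determines the middle letter that acts
  on \<open>v\<close>.\<close>

lemma yd_act_letter_True:
  "eqm R (yd_act act N (wd True [i]) (tens v (wd s (G_word m t k))))
     (tens (vact act (wd True [swap_if s i]) v) (wd s (G_word m t (other k))))"
proof -
  let ?i = "swap_if s i"
  have main: "wd s [i] * wd s (G_word m t k) * wd s [other i] ^ (4 * N - 1) \<sim> wd s (G_word m t (other k))"
    by (rule letter_G_word_letter)
  have zero: "wd (\<not> s) [i] * wd s (G_word m t k) * y \<sim> 0" for y
    by (rule mixed_left) auto
  have "eqm R (yd_act act N (X i (other i)) (tens v (wd s (G_word m t k))))
      (tens (vact act (wd True [?i]) v) (wd s (G_word m t (other k))) + tens (vact act (wd True [other ?i]) v) 0)"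
  proof (cases "?i")
    case I1
    then have X: "X i I1 = (wd s [i] :: 'k free_alg)" "X (other i) I2 = (wd s [other i] :: 'k free_alg)"
      "X i I2 = (wd (\<not> s) [i] :: 'k free_alg)"
      by (cases i; cases s; simp add: X_conv_wd)+
    have "eqm R (tens (vact act (wd True [I1]) v) (X i I1 * wd s (G_word m t k) * X (other i) I2 ^ (4 * N - 1))
       + tens (vact act (wd True [I2]) v) (X i I2 * wd s (G_word m t k) * X (other i) I1 ^ (4 * N - 1)))
      (tens (vact act (wd True [I1]) v) (wd s (G_word m t (other k))) + tens (vact act (wd True [I2]) v) 0)"
      unfolding X by (intro eqm_add eqm_tens_R main zero)
    then show ?thesis unfolding I1 yd_act_letter by (simp only: other.simps add.commute)
  next
    case I2
    then have X: "X i I2 = (wd s [i] :: 'k free_alg)" "X (other i) I1 = (wd s [other i] :: 'k free_alg)"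
      "X i I1 = (wd (\<not> s) [i] :: 'k free_alg)"
      by (cases i; cases s; simp add: X_conv_wd)+
    have "eqm R (tens (vact act (wd True [I2]) v) (X i I2 * wd s (G_word m t k) * X (other i) I1 ^ (4 * N - 1))
       + tens (vact act (wd True [I1]) v) (X i I1 * wd s (G_word m t k) * X (other i) I2 ^ (4 * N - 1)))
      (tens (vact act (wd True [I2]) v) (wd s (G_word m t (other k))) + tens (vact act (wd True [I1]) v) 0)"
      unfolding X by (intro eqm_add eqm_tens_R main zero)
    then show ?thesis unfolding I2 yd_act_letter by (simp only: other.simps)
  qed
  then show ?thesis by (simp add: wd_conv_X tens_simps)
qed

end

section \<open>The Yetter-Drinfeld submodule and its braiding\<close>

locale suzuki_G = suzuki_flip N n \<mu> lam M \<theta> act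
  for N n and \<mu> lam M \<theta> :: "'k::field" and act +
  fixes m t :: nat and c :: "idx \<Rightarrow> 'k"
  assumes c_mult: "c I1 * c I2 = 1" and c_M: "c I2 * \<theta> = c I1 * M"
begin

definition G_vec :: "idx \<Rightarrow> (idx \<times> word \<Rightarrow>\<^sub>0 'k)" where
  "G_vec l = tens (bas l) (wd False (G_word m t l)) + smul (c l) (tens (bas (other l)) (wd True (G_word m t l)))"

lemma c_other: "c l * c (other l) = 1"
  using c_mult by (cases l) (simp_all add: mult.commute)

lemma c_nz: "c l \<noteq> 0"
  using c_other[of l] by auto

text \<open>The compatibility that makes both summands of \<open>G_vec l\<close> scale by the same
  factor under an off-diagonal letter.\<close>

lemma c_coef: "c l * coef M \<theta> (other i) (other l) = coef M \<theta> i l * c (other l)"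
  using c_M theta_nz by (cases l; cases i) (simp_all add: field_simps)

lemma lin_yd_act1: "lin (yd_act act N h)"
  using lin_yd_act[OF lin_id] .

lemma yd_act_letter_True_G_vec:
  "eqm R (yd_act act N (wd True [i]) (G_vec l)) (smul (coef M \<theta> i l) (G_vec (other l)))"
proof -
  have "yd_act act N (wd True [i]) (G_vec l) = yd_act act N (wd True [i]) (tens (bas l) (wd False (G_word m t l)))
      + smul (c l) (yd_act act N (wd True [i]) (tens (bas (other l)) (wd True (G_word m t l))))"
    by (simp only: G_vec_def lin_add[OF lin_yd_act1] lin_smul[OF lin_yd_act1])
  also have "eqm R \<dots> (tens (vact act (wd True [swap_if False i]) (bas l)) (wd False (G_word m t (other l)))
      + smul (c l) (tens (vact act (wd True [swap_if True i]) (bas (other l))) (wd True (G_word m t (other l)))))"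
    by (intro eqm_add eqm_smul yd_act_letter_True)
  also have "\<dots> = smul (coef M \<theta> i l) (G_vec (other l))"
    by (simp add: vact_letter_True G_vec_def tens_simps fs.scale_right_distrib c_coef)
  finally show ?thesis .
qed

lemma yd_act_letter_False_G_vec: "eqm R (yd_act act N (wd False [i]) (G_vec l)) 0"
proof -
  have "yd_act act N (wd False [i]) (G_vec l) = yd_act act N (wd False [i]) (tens (bas l) (wd False (G_word m t l)))
      + smul (c l) (yd_act act N (wd False [i]) (tens (bas (other l)) (wd True (G_word m t l))))"
    by (simp only: G_vec_def lin_add[OF lin_yd_act1] lin_smul[OF lin_yd_act1])
  also have "eqm R \<dots> (0 + smul (c l) 0)"
    by (intro eqm_add eqm_smul yd_act_letter_False G_word_neq_Nil)
  finally show ?thesis by simp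
qed

lemma yd_act_eqm: "eqm R x y \<Longrightarrow> eqm R (yd_act act N h x) (yd_act act N h y)"
  by (rule eqm_lin[OF _ lin_yd_act1]) (auto simp: yd_act_R)

lemma yd_act_wd_True_G_vec:
  "eqm R (yd_act act N (wd True ws) (G_vec l))
     (smul (word_coef M \<theta> ws l) (G_vec (flip_if_odd (length ws) l)))"
  unfolding yd_act_wd[of _ _ _ ws]
  by (rule foldr_word_coef[where u = G_vec]) (rule lin_yd_act1, simp add: yd_act_R, rule yd_act_letter_True_G_vec)

lemma yd_act_wd_False_G_vec:
  assumes "ws \<noteq> []"
  shows "eqm R (yd_act act N (wd False ws) (G_vec l)) 0"
  using assms
proof (induction ws rule: list_nonempty_induct)
  case (single i)
  show ?case by (rule yd_act_letter_False_G_vec)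
next
  case (cons i ws)
  have "eqm R (yd_act act N (wd False [i]) (yd_act act N (wd False ws) (G_vec l))) (yd_act act N (wd False [i]) 0)"
    by (rule yd_act_eqm[OF cons.IH])
  then show ?case by (simp only: wd_Cons[of _ i ws] yd_act_mult lin_0[OF lin_yd_act1])
qed

lemma coact_map_wd_G_word:
  "eqm (rel_tens SI R) (coact_map v (\<Delta> (wd s (G_word m t l))))
     (tens (wd False (G_word m t l)) (tens v (wd s (G_word m t l)))
       + tens (wd True (G_word m t l)) (tens v (wd (\<not> s) (G_word m t (other l)))))"
proof -
  have "eqm SI2 (\<Delta> (wd s (G_word m t l)))
      (tens (wd False (G_word m t l)) (wd s (G_word m t l))
        + tens (wd True (G_word m t l)) (wd (\<not> s) (map other (G_word m t l))))"
    by (rule comult_wd[OF G_word_neq_Nil])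
  also have "eqm SI2 \<dots> (tens (wd False (G_word m t l)) (wd s (G_word m t l))
        + tens (wd True (G_word m t l)) (wd (\<not> s) (G_word m t (other l))))"
    by (intro eqm_add eqm_tens eqm_refl wd_map_other_G_word)
  finally have "eqm (rel_tens SI R) (coact_map v (\<Delta> (wd s (G_word m t l))))
    (coact_map v (tens (wd False (G_word m t l)) (wd s (G_word m t l))
        + tens (wd True (G_word m t l)) (wd (\<not> s) (G_word m t (other l)))))"
    by (rule coact_map_eqm)
  then show ?thesis
    by (simp only: lin_add[OF lin_coact_map[OF lin_id]] coact_map_tens)
qed

lemma yd_coact_G_vec:
  "eqm (rel_tens SI R) (yd_coact (G_vec l))
     (tens (wd False (G_word m t l)) (G_vec l) + smul (c l) (tens (wd True (G_word m t l)) (G_vec (other l))))"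
proof -
  let ?F = "wd False (G_word m t l)" and ?T = "wd True (G_word m t l)"
  have "yd_coact (G_vec l) = coact_map (bas l) (\<Delta> ?F) + smul (c l) (coact_map (bas (other l)) (\<Delta> ?T))"
    by (simp only: G_vec_def yd_coact_tens lin_add[OF lin_yd_coact[OF lin_id]] lin_smul[OF lin_yd_coact[OF lin_id]])
  also have "eqm (rel_tens SI R) \<dots>
     ((tens ?F (tens (bas l) ?F) + tens ?T (tens (bas l) (wd (\<not> False) (G_word m t (other l)))))
     + smul (c l) (tens ?F (tens (bas (other l)) ?T) + tens ?T (tens (bas (other l)) (wd (\<not> True) (G_word m t (other l))))))"
    by (intro eqm_add eqm_smul coact_map_wd_G_word)
  \<comment> \<open>The second summand of \<open>G_vec (other l)\<close> receives the coefficient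
    \<open>c l * c (other l)\<close>, which is 1.\<close>
  also have "\<dots> = tens ?F (G_vec l) + smul (c l) (tens ?T (G_vec (other l)))"
    by (simp add: G_vec_def tens_simps fs.scale_right_distrib c_other add_ac)
  finally show ?thesis .
qed

lemma yd_braid_G_vec:
  "eqm (rel_tens R R) (yd_braid act N (tens (G_vec l) (G_vec l')))
     (smul (c l * word_coef M \<theta> (G_word m t l) l') (tens (G_vec (other l')) (G_vec (other l))))"
proof -
  \<comment> \<open>Odd length is what makes the acting word exchange the two lines.\<close>
  have odd: "odd (length (G_word m t l))" by (simp add: G_word_def)
  have "eqm (rel_tens R R) (yd_braid act N (tens (G_vec l) (G_vec l')))
      (braid_map act N (G_vec l') (tens (wd False (G_word m t l)) (G_vec l) + smul (c l) (tens (wd True (G_word m t l)) (G_vec (other l)))))"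
    unfolding yd_braid_tens by (rule braid_map_eqm[OF yd_coact_G_vec])
  also have "braid_map act N (G_vec l') (tens (wd False (G_word m t l)) (G_vec l) + smul (c l) (tens (wd True (G_word m t l)) (G_vec (other l))))
      = tens (yd_act act N (wd False (G_word m t l)) (G_vec l')) (G_vec l)
        + smul (c l) (tens (yd_act act N (wd True (G_word m t l)) (G_vec l')) (G_vec (other l)))"
    by (simp only: lin_add[OF lin_braid_map[OF lin_id]] lin_smul[OF lin_braid_map[OF lin_id]] braid_map_tens)
  also have "eqm (rel_tens R R) \<dots> (tens 0 (G_vec l)
        + smul (c l) (tens (smul (word_coef M \<theta> (G_word m t l) l')
            (G_vec (flip_if_odd (length (G_word m t l)) l'))) (G_vec (other l))))"
    by (intro eqm_add eqm_smul eqm_tens eqm_refl yd_act_wd_True_G_vec yd_act_wd_False_G_vec G_word_neq_Nil)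
  also have "\<dots> = smul (c l * word_coef M \<theta> (G_word m t l) l') (tens (G_vec (other l')) (G_vec (other l)))"
    using odd by (simp add: tens_simps)
  finally show ?thesis .
qed

text \<open>
  \<open>V'\<close> itself separates \<open>w\<^sub>1\<close> from \<open>w\<^sub>2\<close> modulo the relations: on it the words in \<open>x\<^sub>1\<^sub>2, x\<^sub>2\<^sub>1\<close> are
  invertible and those in \<open>x\<^sub>1\<^sub>1, x\<^sub>2\<^sub>2\<close> vanish.
\<close>
definition proj :: "idx \<Rightarrow> (idx \<times> word \<Rightarrow>\<^sub>0 'k) \<Rightarrow> (idx \<Rightarrow>\<^sub>0 'k)" where
  "proj l0 = lin_ext (\<lambda>(l, g). smul (Poly_Mapping.lookup (bas l) l0) (vact act (bas g) (bas I1)))"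

lemma lin_proj: "lin (proj l0)"
  unfolding proj_def by (rule lin_lin_ext)

lemma proj_tens: "proj l0 (tens v g) = smul (Poly_Mapping.lookup v l0) (vact act g (bas I1))"
  unfolding proj_def
proof (rule lin_ext_bilinear)
  show "lin (\<lambda>p. smul (Poly_Mapping.lookup p l0) (vact act q (bas I1)))" for q
    by (rule linI) (simp_all add: lookup_add lookup_smul fs.scale_left_distrib)
  show "lin (\<lambda>q. smul (Poly_Mapping.lookup p l0) (vact act q (bas I1)))" for p
    by (intro lin_intros)
qed

lemma proj_R: "x \<in> R \<Longrightarrow> proj l0 x = 0"
proof -
  assume "x \<in> R"
  then have "proj l0 x \<in> fs.span {}"
    by (rule lin_R[OF _ lin_proj]) (simp add: proj_tens vact_ideal)
  then show ?thesis by simp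
qed

lemma coef_nz: "coef M \<theta> i l \<noteq> 0"
  using M_nz theta_nz by (cases i; cases l) auto

lemma word_coef_nz: "word_coef M \<theta> ws l \<noteq> 0"
  by (induction ws) (simp_all add: coef_nz)

lemma lin_ext_idx: "lin_ext f u = smul (Poly_Mapping.lookup u I1) (f I1) + smul (Poly_Mapping.lookup u I2) (f I2)"
proof -
  have "x \<in> {I1, I2}" for x by (cases x) auto
  then show ?thesis by (subst lin_ext_superset[of "{I1, I2}"]) auto
qed

lemma G_vec_independent:
  assumes "lin_ext G_vec u \<in> R"
  shows "u = 0"
proof (rule poly_mapping_eqI)
  fix l
  have odd: "odd (length (G_word m t l'))" for l' by (simp add: G_word_def)
  \<comment> \<open>The first summand of \<open>G_vec l'\<close> is killed because its word is
    diagonal. The second has \<open>V\<close>-component \<open>other l'\<close>, and its word, of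
    odd length, sends \<open>bas I1\<close> to a nonzero multiple of \<open>bas I2\<close>.\<close>
  have pw: "proj l0 (G_vec l') = (if l0 = other l'
      then smul (c l' * word_coef M \<theta> (G_word m t l') I1) (bas I2) else 0)" for l0 l'
    using odd[of l']
    by (cases l0; cases l')
      (simp_all add: G_vec_def lin_add[OF lin_proj] lin_smul[OF lin_proj] proj_tens vact_wd_False
        vact_wd_True lookup_single)
  have "0 = proj (other l) (lin_ext G_vec u)"
    using assms by (simp add: proj_R)
  also have "\<dots> = smul (Poly_Mapping.lookup u l * (c l * word_coef M \<theta> (G_word m t l) I1)) (bas I2)"
    by (cases l) (simp_all add: lin_ext_idx lin_add[OF lin_proj] lin_smul[OF lin_proj] pw)
  finally have "Poly_Mapping.lookup u l * (c l * word_coef M \<theta> (G_word m t l) I1) = 0"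
    by (metis lookup_single_eq lookup_smul lookup_zero mult.right_neutral)
  then show "Poly_Mapping.lookup u l = Poly_Mapping.lookup 0 l"
    by (simp add: c_nz word_coef_nz)
qed

lemma span_G_vec: "fs.span ({G_vec I1, G_vec I2} \<union> R) = {lin_ext G_vec u + r |u r. r \<in> R}"
proof -
  have "lin_ext G_vec u \<in> fs.span {G_vec I1, G_vec I2}" for u
    unfolding lin_ext_idx by (intro fs.span_add fs.span_scale fs.span_base) simp_all
  moreover have "\<exists>u. x = lin_ext G_vec u" if "x \<in> fs.span {G_vec I1, G_vec I2}" for x
  proof -
    from that obtain a b where "x = smul a (G_vec I1) + smul b (G_vec I2)"
      by (auto simp: fs.span_insert fs.span_empty algebra_simps)
    then have "x = lin_ext G_vec (smul a (bas I1) + smul b (bas I2))"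
      by (simp only: lin_add[OF lin_lin_ext] lin_smul[OF lin_lin_ext] lin_ext_bas)
    then show ?thesis by blast
  qed
  ultimately show ?thesis
    unfolding fs.span_Un span_R by blast
qed

text \<open>The isomorphism sends v_l to \<open>G_vec l\<close>. The braiding fixes the two tensors
  with distinct indices up to scalars; \<open>b\<close> and \<open>b'\<close> say that these scalars
  agree, as the type requires.\<close>

theorem type_V_abe:
  assumes a: "a = c I1 * word_coef M \<theta> (G_word m t I1) I1"
    and b: "b = c I1 * word_coef M \<theta> (G_word m t I1) I2"
    and b': "b = c I2 * word_coef M \<theta> (G_word m t I2) I1"
    and e: "e = c I2 * word_coef M \<theta> (G_word m t I2) I2"
  shows "is_type_V_abe a b e (fs.span ({G_vec I1, G_vec I2} \<union> R)) R (yd_braid act N)"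
proof -
  have "yd_braid act N (map_tens (lin_ext G_vec) (lin_ext G_vec) z) -
      map_tens (lin_ext G_vec) (lin_ext G_vec) (V_abe_braid a b e z) \<in> fs.span (rel_tens R R)" (is "?f z \<in> _") for z
  proof (rule bas_pair_span[where f = ?f])
    show "lin ?f" unfolding V_abe_braid_def by (intro lin_intros)
    fix l l'
    have mt: "map_tens (lin_ext G_vec) (lin_ext G_vec) (tens (bas i) (bas j)) = tens (G_vec i) (G_vec j)" for i j
      by (simp only: map_tens_tens lin_lin_ext lin_ext_bas)
    have "V_abe_braid a b e (tens (bas l) (bas l'))
        = smul (c l * word_coef M \<theta> (G_word m t l) l') (tens (bas (other l')) (bas (other l)))"
      using a b b' e by (cases l; cases l') (simp_all add: V_abe_braid_def)
    then have "map_tens (lin_ext G_vec) (lin_ext G_vec) (V_abe_braid a b e (tens (bas l) (bas l')))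
        = smul (c l * word_coef M \<theta> (G_word m t l) l') (tens (G_vec (other l')) (G_vec (other l)))"
      by (simp only: lin_smul[OF lin_map_tens[OF lin_id]] mt)
    then show "?f (tens (bas l) (bas l')) \<in> fs.span (rel_tens R R)"
      using yd_braid_G_vec[of l l'] by (simp only: mt eqm_def)
  qed
  then have "\<forall>z. yd_braid act N (map_tens (lin_ext G_vec) (lin_ext G_vec) z) -
      map_tens (lin_ext G_vec) (lin_ext G_vec) (V_abe_braid a b e z) \<in> rel_tens R R" by simp
  moreover have "a \<noteq> 0" "b \<noteq> 0" "e \<noteq> 0"
    using a b e by (simp_all add: c_nz word_coef_nz)
  ultimately show ?thesis
    unfolding is_type_V_abe_def
    using yd_braid_R span_G_vec G_vec_independent lin_lin_ext[of G_vec] by blast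
qed

lemma word_coef_G_word:
  "word_coef M \<theta> (G_word m t i) l
    = M ^ m * (coef M \<theta> i l * (coef M \<theta> (other i) (other l) * coef M \<theta> i l) ^ t)"
  unfolding G_word_def word_coef_append word_coef_replicate[OF theta_nz] word_coef_alt_odd ..

end

section \<open>Specialisation to the given roots of unity\<close>

theorem lemma4p13:
  fixes \<mu> lam \<omega> q :: "'k::{alg_closed_field, field_char_0}"
    and N n j k p s t :: nat
  assumes "N \<ge> 1" and "n \<ge> 1"
    and "\<mu> \<in> {1, -1}" and "lam \<in> {1, -1}"
    and "primitive_root_of_one (8 * n * N) \<omega>"
    and "q ^ 2 = mu_bar n \<mu> \<omega>"
    and "1 \<le> s" and "s \<le> N" and "t \<le> n - 1" and "k \<le> N - 1" and "p \<in> {0, 1}"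
    and "lam = 1 \<Longrightarrow> \<exists>i\<in>{1..n - 1}. j = 2 * i"
    and "lam = -1 \<Longrightarrow> \<exists>i\<in>{1..n}. j + 1 = 2 * i"
  shows "\<exists>a b e. nichols_G_of_type_V_abe a b e N n \<mu> lam \<omega> q j k p s t
     \<and> a * e = mu_bar n \<mu> \<omega> ^ (2 * s + 2 * t + 1)
           * \<omega> powi (4 * int k * int n * (4 * int s + 4 * int t + 2)
                      + int j * int N * (- 2 - 4 * int t))
     \<and> b = (- 1) ^ p * (mu_bar n \<mu> \<omega> ^ (s + t) * q)
           * \<omega> powi (4 * int n * int k * (2 * int s + 2 * int t + 1)
                      + int j * int N * (2 * int t + 1))"
proof -
  define mb where "mb = mu_bar n \<mu> \<omega>"
  \<comment> \<open>All powers of \<omega> in the module, the vectors and the result become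
    monomials in \<open>x\<close> and \<open>y\<close>, possibly with negative exponents.\<close>
  define x where "x = \<omega> ^ (4 * k * n)"
  define y where "y = \<omega> ^ (j * N)"
  define M where "M = mb * x ^ 2"
  define \<theta> where "\<theta> = y ^ 2"
  define act where "act = V'_act N n \<mu> \<omega> j k"
  \<comment> \<open>The coefficients of the second summands of w_1 and w_2.\<close>
  define c where "c = (\<lambda>l. case l of I1 \<Rightarrow> (- 1) ^ p * (y / x) / q | I2 \<Rightarrow> (- 1) ^ p * q * (x / y))"
  have om: "\<omega> ^ (8 * n * N) = 1" and prim: "\<And>i. 0 < i \<Longrightarrow> i < 8 * n * N \<Longrightarrow> \<omega> ^ i \<noteq> 1"
    using assms(5) by (auto simp: primitive_root_of_one_def)
  have om_nz: "\<omega> \<noteq> 0"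
    using om assms(1,2) by (auto simp: power_0_left)
  \<comment> \<open>By primitivity this is a square root of 1 different from 1.\<close>
  have half: "\<omega> ^ (4 * n * N) = -1"
  proof -
    have "\<omega> ^ (4 * n * N) * \<omega> ^ (4 * n * N) = 1"
      unfolding power_add[symmetric] om[symmetric] by (simp add: mult_ac)
    moreover have "\<omega> ^ (4 * n * N) \<noteq> 1"
      using assms(1,2) by (intro prim) auto
    ultimately show ?thesis by (simp add: square_eq_1_iff)
  qed
  have mb_nz: "mb \<noteq> 0" using om_nz by (simp add: mb_def mu_bar_def)
  have q_sq: "q * q = mb" using assms(6) by (simp add: mb_def power2_eq_square)
  have q_nz: "q \<noteq> 0" using q_sq mb_nz by auto
  have xy_nz: "x \<noteq> 0" "y \<noteq> 0" using om_nz by (simp_all add: x_def y_def)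
  have sg: "(- 1) ^ p * (- 1) ^ p = (1 :: 'k)" by (simp flip: power_add)
  have powi_x: "\<omega> powi (4 * int k * int n) = x" and powi_y: "\<omega> powi (int j * int N) = y"
    using power_int_of_nat[of \<omega> "4 * k * n"] power_int_of_nat[of \<omega> "j * N"] by (simp_all add: x_def y_def)
  have powi_xm: "\<omega> powi (4 * int k * int n * int m) = x ^ m" for m
    using power_int_mult[of \<omega> "4 * int k * int n" "int m"] by (simp only: powi_x power_int_of_nat)
  have powi_ym: "\<omega> powi (int j * int N * int m) = y ^ m" for m
    using power_int_mult[of \<omega> "int j * int N" "int m"] by (simp only: powi_y power_int_of_nat)
  have powi_xy: "\<omega> powi (4 * int k * int n - int j * int N) = x / y"
    "\<omega> powi (int j * int N - 4 * int k * int n) = y / x"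
    using om_nz by (simp_all add: power_int_diff powi_x powi_y)
  \<comment> \<open>The power of \<theta> is (-1)^j, and the range prescribed for \<open>j\<close>
    makes it even for \<open>lam = 1\<close> and odd for \<open>lam = -1\<close>.\<close>
  have y_N: "lam * \<theta> ^ (2 * n) = 1"
  proof -
    have "\<theta> ^ (2 * n) = (\<omega> ^ (4 * n * N)) ^ j"
      by (simp add: \<theta>_def y_def mult_ac flip: power_mult)
    also have "\<dots> = (- 1) ^ j" by (simp only: half)
    also have "\<dots> = lam"
    proof (cases "lam = 1")
      case True
      then show ?thesis using assms(12) by auto
    next
      case False
      then have l: "lam = -1" using assms(4) by auto
      then obtain i where "j + 1 = 2 * i" using assms(13) by blast
      then have "odd j" by presburger
      then show ?thesis using l by simp
    qed
    finally show ?thesis using assms(4) by auto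
  qed
  \<comment> \<open>The factor x^(2N) is a power of \<omega>^(8nN) = 1, so only the N-th power of
    \<open>mb\<close> remains, and this equals \<mu>.\<close>
  have mu_M: "\<mu> * M ^ N = 1"
  proof -
    have "(x ^ 2) ^ N = (\<omega> ^ (8 * n * N)) ^ k"
      by (simp add: x_def mult_ac flip: power_mult)
    then have "(x ^ 2) ^ N = 1" by (simp only: om power_one)
    then have "M ^ N = mb ^ N" by (simp add: M_def power_mult_distrib)
    also have "\<dots> = (if \<mu> = 1 then 1 else -1)"
      using half by (simp add: mb_def mu_bar_def flip: power_mult)
    finally show ?thesis using assms(3) by auto
  qed
  have c1: "c I1 = (- 1) ^ p * (y / x) / q" and c2: "c I2 = (- 1) ^ p * q * (x / y)"
    by (simp_all add: c_def)
  interpret suzuki_G N n \<mu> lam M \<theta> act s t c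
  proof
    show "0 < N" "0 < n" using assms(1,2) by auto
    show "\<mu> * \<mu> = 1" "lam * lam = 1" using assms(3,4) by auto
    show "\<theta> \<noteq> 0" "M \<noteq> 0" using xy_nz mb_nz by (simp_all add: \<theta>_def M_def)
    show "act (i, i) l = 0" for i l by (cases i; cases l) (simp_all add: act_def)
    show "act (i, other i) l = smul (coef M \<theta> i l) (bas (other l))" for i l
    proof -
      have "\<omega> ^ (8 * k * n) = x ^ 2" "\<omega> ^ (2 * j * N) = y ^ 2"
        by (simp_all add: x_def y_def mult_ac flip: power_mult)
      moreover have "\<omega> powi (2 * (4 * int k * int n - int j * int N)) = (x / y) ^ 2"
        using power_int_mult[of \<omega> "4 * int k * int n - int j * int N" 2]
        by (simp only: powi_xy mult.commute[of 2]) simp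
      ultimately show ?thesis
        by (cases i; cases l) (simp_all add: act_def M_def \<theta>_def mb_def power_divide)
    qed
    show "c I1 * c I2 = 1" "c I2 * \<theta> = c I1 * M"
      using xy_nz q_nz sg q_sq by (simp_all add: c_def \<theta>_def M_def field_simps power2_eq_square)
  qed (fact y_N mu_M)+
  have G_word: "G_word s t I1 = replicate (2 * s + 1) I1 @ alt I2 (2 * t)"
    "G_word s t I2 = replicate (2 * s) I1 @ alt I2 (2 * t + 1)"
    by (simp_all add: G_word_def replicate_app_Cons_same)
  have words: "wd False (G_word s t I1) = X I1 I1 ^ (2 * s + 1) * chi I2 I2 (2 * t)"
    "wd True (G_word s t I1) = X I1 I2 ^ (2 * s + 1) * chi I2 I1 (2 * t)"
    "wd False (G_word s t I2) = X I1 I1 ^ (2 * s) * chi I2 I2 (2 * t + 1)"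
    "wd True (G_word s t I2) = X I1 I2 ^ (2 * s) * chi I2 I1 (2 * t + 1)"
    unfolding G_word wd_append wd_replicate chi_conv_wd X_conv_wd by simp_all
  have w1: "G_vec I1 = G_w1 N n \<omega> q j k p s t" and w2: "G_vec I2 = G_w2 N n \<omega> q j k p s t"
    unfolding G_vec_def G_w1_def G_w2_def other.simps words powi_xy c1 c2
    by (simp_all only: times_divide_eq_right)
  define a where "a = c I1 * word_coef M \<theta> (G_word s t I1) I1"
  define b where "b = c I1 * word_coef M \<theta> (G_word s t I1) I2"
  define e where "e = c I2 * word_coef M \<theta> (G_word s t I2) I2"
  \<comment> \<open>The two sides are \<open>c I1 * M\<close> and \<open>c I2 * \<theta>\<close>
    times the common factor M^s (\<theta> M)^t.\<close>
  have "b = c I2 * word_coef M \<theta> (G_word s t I2) I1"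
    using c_M by (simp add: b_def word_coef_G_word mult_ac)
  from type_V_abe[OF a_def b_def this e_def]
  have "nichols_G_of_type_V_abe a b e N n \<mu> lam \<omega> q j k p s t"
    unfolding nichols_G_of_type_V_abe_def G_space_def w1 w2 act_def .
  moreover have "a * e = mb ^ (2 * s + 2 * t + 1)
           * \<omega> powi (4 * int k * int n * (4 * int s + 4 * int t + 2)
                      + int j * int N * (- 2 - 4 * int t))"
  proof -
    have pows: "(x ^ 2) ^ (2 * s + 2 * t + 1) = x ^ (4 * s + 4 * t + 2)" "(y ^ 2) ^ (2 * t + 1) = y ^ (4 * t + 2)"
      unfolding power_mult[symmetric] by (simp_all add: algebra_simps)
    have "4 * int k * int n * (4 * int s + 4 * int t + 2) + int j * int N * (- 2 - 4 * int t)
        = 4 * int k * int n * int (4 * s + 4 * t + 2) - int j * int N * int (4 * t + 2)"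
      by (simp add: algebra_simps)
    then have "\<omega> powi (4 * int k * int n * (4 * int s + 4 * int t + 2) + int j * int N * (- 2 - 4 * int t))
        = x ^ (4 * s + 4 * t + 2) / y ^ (4 * t + 2)"
      using om_nz by (simp only: power_int_diff powi_xm powi_ym not_False_eq_True simp_thms)
    then have 1: "\<omega> powi (4 * int k * int n * (4 * int s + 4 * int t + 2) + int j * int N * (- 2 - 4 * int t))
        = (x ^ 2) ^ (2 * s + 2 * t + 1) / (y ^ 2) ^ (2 * t + 1)"
      by (simp only: pows)
    \<comment> \<open>Here a = c_1 M^s (M / \<theta>)^t and e = c_2 M^s (M /
      \<theta>)^(t+1).\<close>
    have "a * e = (c I1 * c I2) * (M ^ (2 * s + 2 * t + 1) / \<theta> ^ (2 * t + 1))"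
      using theta_nz by (simp add: a_def e_def word_coef_G_word power_divide mult_2 power_add) (simp add: mult_ac)
    then show ?thesis
      unfolding 1 c_mult by (simp add: M_def \<theta>_def power_mult_distrib)
  qed
  moreover have "b = (- 1) ^ p * (mb ^ (s + t) * q)
           * \<omega> powi (4 * int n * int k * (2 * int s + 2 * int t + 1)
                      + int j * int N * (2 * int t + 1))"
  proof -
    have "4 * int n * int k * (2 * int s + 2 * int t + 1) + int j * int N * (2 * int t + 1)
        = 4 * int k * int n * int (2 * s + 2 * t + 1) + int j * int N * int (2 * t + 1)"
      by (simp add: algebra_simps)
    then have "\<omega> powi (4 * int n * int k * (2 * int s + 2 * int t + 1) + int j * int N * (2 * int t + 1))
        = x ^ (2 * s + 2 * t + 1) * y ^ (2 * t + 1)"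
      using om_nz by (simp only: power_int_add powi_xm powi_ym not_False_eq_True simp_thms)
    then have 1: "\<omega> powi (4 * int n * int k * (2 * int s + 2 * int t + 1) + int j * int N * (2 * int t + 1))
        = x * x ^ (2 * s) * x ^ (2 * t) * (y * y ^ (2 * t))"
      by (simp add: power_add)
    have "b = (- 1) ^ p * (y / x) / q * (M ^ s * (M * (\<theta> * M) ^ t))"
      by (simp add: b_def word_coef_G_word c1)
    \<comment> \<open>The single factor M = mb x^2 cancels the denominator x; with mb = q^2 it then
      turns 1/q into q.\<close>
    also have "\<dots> = (- 1) ^ p * (y * x / q * mb) * mb ^ s * mb ^ t * x ^ (2 * s) * x ^ (2 * t) * y ^ (2 * t)"
      using xy_nz unfolding M_def \<theta>_def power_mult_distrib power_mult
      by (simp add: power2_eq_square field_simps)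
    also have "mb = q * q" by (simp only: q_sq)
    finally show ?thesis unfolding 1 q_sq[symmetric]
      using q_nz by (simp add: power_add field_simps)
  qed
  ultimately show ?thesis unfolding mb_def by blast
qed

end
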